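(* Let $\lambda_1,\lambda_2,\lambda_3,\lambda_4\in\mathbb{R}$ and let $G$ be a connected $4$-dimensional Lie group with a global basis $\{X_1,X_2,X_3,X_4\}$ of left invariant vector fields satisfying \[ \begin{aligned} [X_1,X_2]&=\lambda_1X_3+\lambda_2X_4, & [X_2,X_3]&=\lambda_1X_1+\lambda_3X_4,\\ [X_1,X_3]&=-\lambda_1X_2+\lambda_4X_4, & [X_2,X_4]&=\lambda_2X_1-\lambda_3X_3,\\ [X_1,X_4]&=-\lambda_2X_2-\lambda_4X_3, & [X_3,X_4]&=\lambda_4X_1+\lambda_3X_2 . \end{aligned} \] Let $g$ be the left invariant Riemannian metric for which $\{X_i\}$ is orthonormal, and let $P$ be the left invariant almost product structure with $PX_1=X_3$, $PX_2=X_4$, $PX_3=X_1$, $PX_4=X_2$. Then: (i) $(G,P,g)$ is a locally symmetric ($\nabla R=0$) $\mathcal{W}_3$-manifold, $g$ is a Killing metric, and the Weyl tensor of $g$ is zero. (ii) The components $F_{ijk}=F(X_i,X_j,X_k)$, $R_{ijks}=R(X_i,X_j,X_k,X_s)$, $\rho_{ij}=\rho(X_i,X_j)$ are as follows, all components not listed and not obtained from the listed ones by the symmetries $F_{ijk}=F_{ikj}$, $R_{ijks}=R_{ksij}$, $R_{ijks}=-R_{jiks}=-R_{ijsk}$, $\rho_{ij}=\rho_{ji}$ being zero: \[ \begin{aligned} &F_{211}=-F_{233}=2F_{134}=2F_{323}=-2F_{112}=-2F_{314}=\lambda_1,\\ &F_{144}=-F_{122}=2F_{212}=2F_{423}=-2F_{234}=-2F_{414}=\lambda_2,\\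 &F_{322}=-F_{344}=2F_{214}=2F_{434}=-2F_{223}=-2F_{412}=\lambda_3,\\ &F_{433}=-F_{411}=2F_{141}=2F_{321}=-2F_{132}=-2F_{334}=\lambda_4; \end{aligned} \] \[ \begin{aligned} &R_{1221}=\tfrac14(\lambda_1^2+\lambda_2^2),\quad R_{1331}=\tfrac14(\lambda_1^2+\lambda_4^2),\quad R_{1441}=\tfrac14(\lambda_2^2+\lambda_4^2),\\ &R_{2332}=\tfrac14(\lambda_1^2+\lambda_3^2),\quad R_{2442}=\tfrac14(\lambda_2^2+\lambda_3^2),\quad R_{3443}=\tfrac14(\lambda_3^2+\lambda_4^2),\\ &R_{1341}=R_{2342}=\tfrac14\lambda_1\lambda_2,\quad R_{3123}=R_{4124}=\tfrac14\lambda_3\lambda_4,\quad R_{1231}=R_{4234}=\tfrac14\lambda_2\lambda_4,\\ &R_{2142}=R_{3143}=\tfrac14\lambda_1\lambda_3,\quad R_{1241}=R_{3243}=-\tfrac14\lambda_1\lambda_4,\quad R_{2132}=R_{4134}=-\tfrac14\lambda_2\lambda_3; \end{aligned} \] \[ \begin{aligned} &\rho_{11}=\tfrac12(\lambda_1^2+\lambda_2^2+\lambda_4^2),\quad \rho_{22}=\tfrac12(\lambda_1^2+\lambda_2^2+\lambda_3^2),\\ &\rho_{33}=\tfrac12(\lambda_1^2+\lambda_3^2+\lambda_4^2),\quad \rho_{44}=\tfrac12(\lambda_2^2+\lambda_3^2+\lambda_4^2),\\ &\rho_{12}=\tfrac12\lambda_3\lambda_4,\quad \rho_{13}=-\tfrac12\lambda_2\lambda_3,\quad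 \rho_{14}=\tfrac12\lambda_1\lambda_3,\\ &\rho_{23}=\tfrac12\lambda_2\lambda_4,\quad \rho_{24}=-\tfrac12\lambda_1\lambda_4,\quad \rho_{34}=\tfrac12\lambda_1\lambda_2 . \end{aligned} \] (iii) $\|N\|^2=32(\lambda_1^2+\lambda_2^2+\lambda_3^2+\lambda_4^2)$ and $\|\nabla P\|^2=4(\lambda_1^2+\lambda_2^2+\lambda_3^2+\lambda_4^2)$. (iv) The scalar curvature is $\tau=\tfrac32(\lambda_1^2+\lambda_2^2+\lambda_3^2+\lambda_4^2)$, and the sectional curvatures $k_{ij}$ of the basic $2$-planes $\alpha_{ij}=\mathrm{span}(X_i,X_j)$ are \[ \begin{aligned} &k_{12}=\tfrac14(\lambda_1^2+\lambda_2^2),\quad k_{13}=\tfrac14(\lambda_1^2+\lambda_4^2),\quad k_{14}=\tfrac14(\lambda_2^2+\lambda_4^2),\\ &k_{23}=\tfrac14(\lambda_1^2+\lambda_3^2),\quad k_{24}=\tfrac14(\lambda_2^2+\lambda_3^2),\quad k_{34}=\tfrac14(\lambda_3^2+\lambda_4^2). \end{aligned} \]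
   Context: An almost product structure is a $(1,1)$-tensor field $P$ with $P^2=\mathrm{id}$. Let $\nabla$ be the Levi-Civita connection of $g$. Conventions: - $F(x,y,z)=g((\nabla_xP)y,z)$; $\mathcal{W}_3$-manifold means $F(x,y,z)+F(y,z,x)+F(z,x,y)=0$ for all $x,y,z$. - A left invariant metric $g$ is Killing if $g([X,Y],Z)+g([X,Z],Y)=0$ for all left invariant vector fields $X,Y,Z$. - $R(x,y)z=\nabla_x\nabla_yz-\nabla_y\nabla_xz-\nabla_{[x,y]}z$ and $R(x,y,z,w)=g(R(x,y)z,w)$. - $\rho(y,z)=g^{ij}R(e_i,y,z,e_j)$, $\tau=g^{ij}\rho(e_i,e_j)$, for any basis $\{e_i\}$ of the tangent space, $(g^{ij})$ being the inverse matrix of $(g(e_i,e_j))$. - $\pi_1(x,y,z,w)=g(y,z)g(x,w)-g(x,z)g(y,w)$; the sectional curvature of the nondegenerate plane spanned by $x,y$ is $R(x,y,y,x)/\pi_1(x,y,y,x)$. - Weyl tensor in dimension $4$: $W=R-\frac12\left(\psi_1(\rho)-\frac{\tau}{3}\pi_1\right)$, where $\psi_1(\rho)(x,y,z,w)=g(y,z)\rho(x,w)-g(x,z)\rho(y,w)+\rho(y,z)g(x,w)-\rho(x,z)g(y,w)$. - $N$ is the Nijenhuis tensor of $P$: $N(x,y)=[x,y]+[Px,Py]-P[Px,y]-P[x,Py]$; $\|N\|^2=g^{ij}g^{ks}g(N(e_i,e_k),N(e_j,e_s))$. - $\|\nabla P\|^2=g^{ij}g^{ks}g((\nabla_{e_i}P)e_k,(\nabla_{e_j}P)e_s)$.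 *)

theory Defs
  imports "HOL-Analysis.Analysis" "HOL-Library.Function_Algebras"
begin

section \<open>Smooth manifolds\<close>

text \<open>Functions form a real vector space pointwise; \<open>Function_Algebras\<close> already provides
  the ring operations. This makes \<^const>\<open>span\<close> and \<^const>\<open>independent\<close> available for tangent
  vectors, which are functionals on smooth functions.\<close>

instantiation "fun" :: (type, real_vector) real_vector
begin

definition scaleR_fun :: "real \<Rightarrow> ('a \<Rightarrow> 'b) \<Rightarrow> 'a \<Rightarrow> 'b"
  where "scaleR_fun c f = (\<lambda>x. c *\<^sub>R f x)"

instance
  by standard (simp_all add: scaleR_fun_def fun_eq_iff scaleR_add_right scaleR_add_left)

end

text \<open>The set \<open>S\<close> is meant to be open and the spaces finite-dimensional; then \<open>Ck_on n S f\<close>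
  says that \<open>f\<close> has continuous partial derivatives up to order \<open>n\<close> on \<open>S\<close>.\<close>

primrec Ck_on ::
  "nat \<Rightarrow> 'e::real_normed_vector set \<Rightarrow> ('e \<Rightarrow> 'f::real_normed_vector) \<Rightarrow> bool" where
  "Ck_on 0 S f \<longleftrightarrow> continuous_on S f"
| "Ck_on (Suc n) S f \<longleftrightarrow>
     (\<forall>x\<in>S. f differentiable (at x)) \<and> (\<forall>v. Ck_on n S (\<lambda>x. frechet_derivative f (at x) v))"

definition smooth_on :: "'e::real_normed_vector set \<Rightarrow> ('e \<Rightarrow> 'f::real_normed_vector) \<Rightarrow> bool"
  where "smooth_on S f \<longleftrightarrow> (\<forall>n. Ck_on n S f)"

text \<open>A manifold is a whole type; Hausdorffness and second countability come from its type class.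
  A chart \<open>(U, \<phi>)\<close> is a homeomorphism of the open set \<open>U\<close> onto an open subset of the
  model space, and an atlas is a smoothly compatible family of charts covering the type.\<close>

type_synonym ('a, 'e) chart = "'a set \<times> ('a \<Rightarrow> 'e)"

definition smooth_atlas ::
  "('a::{t2_space,second_countable_topology}, 'e::euclidean_space) chart set \<Rightarrow> bool" where
  "smooth_atlas A \<longleftrightarrow>
     (\<Union>(U, \<phi>)\<in>A. U) = UNIV \<and>
     (\<forall>(U, \<phi>)\<in>A. open U \<and> open (\<phi> ` U) \<and> homeomorphism U (\<phi> ` U) \<phi> (inv_into U \<phi>)) \<and>
     (\<forall>(U, \<phi>)\<in>A. \<forall>(V, \<psi>)\<in>A. smooth_on (\<phi> ` (U \<inter> V)) (\<psi> \<circ> inv_into U \<phi>))"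

definition smooth_fun :: "('a, 'e::euclidean_space) chart set \<Rightarrow> ('a \<Rightarrow> real) \<Rightarrow> bool" where
  "smooth_fun A f \<longleftrightarrow> (\<forall>(U, \<phi>)\<in>A. smooth_on (\<phi> ` U) (f \<circ> inv_into U \<phi>))"

definition smooth_map ::
  "('a::topological_space, 'e::euclidean_space) chart set \<Rightarrow>
   ('b::topological_space, 'f::euclidean_space) chart set \<Rightarrow> ('a \<Rightarrow> 'b) \<Rightarrow> bool" where
  "smooth_map A B h \<longleftrightarrow>
     continuous_on UNIV h \<and>
     (\<forall>(U, \<phi>)\<in>A. \<forall>(V, \<psi>)\<in>B. smooth_on (\<phi> ` (U \<inter> h -` V)) (\<psi> \<circ> h \<circ> inv_into U \<phi>))"

definition prod_atlas ::
  "('a, 'e) chart set \<Rightarrow> ('b, 'f) chart set \<Rightarrow> ('a \<times> 'b, 'e \<times> 'f) chart set" where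
  "prod_atlas A B = {(U \<times> V, map_prod \<phi> \<psi>) | U \<phi> V \<psi>. (U, \<phi>) \<in> A \<and> (V, \<psi>) \<in> B}"

definition lie_group ::
  "('a::{t2_space,second_countable_topology}, 'e::euclidean_space) chart set \<Rightarrow>
   ('a \<Rightarrow> 'a \<Rightarrow> 'a) \<Rightarrow> 'a \<Rightarrow> ('a \<Rightarrow> 'a) \<Rightarrow> bool" where
  "lie_group A mul e iv \<longleftrightarrow>
     group mul e iv \<and> smooth_atlas A \<and>
     smooth_map (prod_atlas A A) A (\<lambda>(x, y). mul x y) \<and> smooth_map A A iv"


section \<open>Tangent vectors and vector fields\<close>

text \<open>Tangent vectors at \<open>p\<close> are the derivations at \<open>p\<close> of the algebra of smooth functions.
  They are total functionals on all functions, so they are required to vanish on non-smooth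
  arguments; otherwise equality of tangent vectors would depend on irrelevant values.\<close>

type_synonym 'a tvec = "('a \<Rightarrow> real) \<Rightarrow> real"
type_synonym 'a vfield = "'a \<Rightarrow> 'a tvec"
type_synonym 'a bilin_field = "'a \<Rightarrow> 'a tvec \<Rightarrow> 'a tvec \<Rightarrow> real"
type_synonym 'a endo_field = "'a \<Rightarrow> 'a tvec \<Rightarrow> 'a tvec"

definition tangent_space :: "('a, 'e::euclidean_space) chart set \<Rightarrow> 'a \<Rightarrow> 'a tvec set" where
  "tangent_space A p = {v.
     (\<forall>f. \<not> smooth_fun A f \<longrightarrow> v f = 0) \<and>
     (\<forall>f h. smooth_fun A f \<longrightarrow> smooth_fun A h \<longrightarrow> v (f + h) = v f + v h) \<and>
     (\<forall>c f. smooth_fun A f \<longrightarrow> v (c *\<^sub>R f) = c * v f) \<and>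
     (\<forall>f h. smooth_fun A f \<longrightarrow> smooth_fun A h \<longrightarrow> v (f * h) = f p * v h + h p * v f)}"

definition vector_field :: "('a, 'e::euclidean_space) chart set \<Rightarrow> 'a vfield \<Rightarrow> bool" where
  "vector_field A X \<longleftrightarrow>
     (\<forall>p. X p \<in> tangent_space A p) \<and> (\<forall>f. smooth_fun A f \<longrightarrow> smooth_fun A (\<lambda>p. X p f))"

definition lie_bracket :: "'a vfield \<Rightarrow> 'a vfield \<Rightarrow> 'a vfield" where
  "lie_bracket X Y = (\<lambda>p f. X p (\<lambda>q. Y q f) - Y p (\<lambda>q. X q f))"

definition tangent_basis ::
  "('a, 'e::euclidean_space) chart set \<Rightarrow> 'a \<Rightarrow> ('i \<Rightarrow> 'a tvec) \<Rightarrow> bool" where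
  "tangent_basis A p e \<longleftrightarrow>
     inj e \<and> independent (range e) \<and> span (range e) = tangent_space A p"

text \<open>Differential of a smooth map \<open>h\<close>, where \<open>A\<close> is the atlas of its codomain.\<close>

definition pushforward ::
  "('b, 'e::euclidean_space) chart set \<Rightarrow> ('a \<Rightarrow> 'b) \<Rightarrow> 'a tvec \<Rightarrow> 'b tvec" where
  "pushforward A h v = (\<lambda>f. if smooth_fun A f then v (f \<circ> h) else 0)"

definition left_invariant ::
  "('a, 'e::euclidean_space) chart set \<Rightarrow> ('a \<Rightarrow> 'a \<Rightarrow> 'a) \<Rightarrow> 'a vfield \<Rightarrow> bool" where
  "left_invariant A mul X \<longleftrightarrow>
     vector_field A X \<and> (\<forall>a p. X (mul a p) = pushforward A (mul a) (X p))"


section \<open>Metrics, almost product structures, the Levi-Civita connection\<close>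

definition riemannian_metric ::
  "('a, 'e::euclidean_space) chart set \<Rightarrow> 'a bilin_field \<Rightarrow> bool" where
  "riemannian_metric A g \<longleftrightarrow>
     (\<forall>p. \<forall>u\<in>tangent_space A p. \<forall>v\<in>tangent_space A p. g p u v = g p v u) \<and>
     (\<forall>p. \<forall>u\<in>tangent_space A p. \<forall>v\<in>tangent_space A p. \<forall>w\<in>tangent_space A p.
        g p (u + v) w = g p u w + g p v w) \<and>
     (\<forall>p c. \<forall>u\<in>tangent_space A p. \<forall>v\<in>tangent_space A p. g p (c *\<^sub>R u) v = c * g p u v) \<and>
     (\<forall>p. \<forall>u\<in>tangent_space A p. u \<noteq> 0 \<longrightarrow> g p u u > 0) \<and>
     (\<forall>X Y. vector_field A X \<longrightarrow> vector_field A Y \<longrightarrow> smooth_fun A (\<lambda>p. g p (X p) (Y p)))"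

definition left_invariant_metric ::
  "('a, 'e::euclidean_space) chart set \<Rightarrow> ('a \<Rightarrow> 'a \<Rightarrow> 'a) \<Rightarrow> 'a bilin_field \<Rightarrow> bool" where
  "left_invariant_metric A mul g \<longleftrightarrow>
     riemannian_metric A g \<and>
     (\<forall>a p. \<forall>u\<in>tangent_space A p. \<forall>v\<in>tangent_space A p.
        g (mul a p) (pushforward A (mul a) u) (pushforward A (mul a) v) = g p u v)"

definition app_endo :: "'a endo_field \<Rightarrow> 'a vfield \<Rightarrow> 'a vfield" where
  "app_endo P X = (\<lambda>p. P p (X p))"

definition tensor_field_1_1 ::
  "('a, 'e::euclidean_space) chart set \<Rightarrow> 'a endo_field \<Rightarrow> bool" where
  "tensor_field_1_1 A P \<longleftrightarrow>
     (\<forall>p. \<forall>u\<in>tangent_space A p. P p u \<in> tangent_space A p) \<and>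
     (\<forall>p. \<forall>u\<in>tangent_space A p. \<forall>v\<in>tangent_space A p. P p (u + v) = P p u + P p v) \<and>
     (\<forall>p c. \<forall>u\<in>tangent_space A p. P p (c *\<^sub>R u) = c *\<^sub>R P p u) \<and>
     (\<forall>X. vector_field A X \<longrightarrow> vector_field A (app_endo P X))"

definition almost_product ::
  "('a, 'e::euclidean_space) chart set \<Rightarrow> 'a endo_field \<Rightarrow> bool" where
  "almost_product A P \<longleftrightarrow>
     tensor_field_1_1 A P \<and> (\<forall>p. \<forall>u\<in>tangent_space A p. P p (P p u) = u)"

definition left_invariant_endo ::
  "('a, 'e::euclidean_space) chart set \<Rightarrow> ('a \<Rightarrow> 'a \<Rightarrow> 'a) \<Rightarrow> 'a endo_field \<Rightarrow> bool" where
  "left_invariant_endo A mul P \<longleftrightarrow>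
     tensor_field_1_1 A P \<and>
     (\<forall>a p. \<forall>u\<in>tangent_space A p.
        P (mul a p) (pushforward A (mul a) u) = pushforward A (mul a) (P p u))"

text \<open>\<open>D X Y\<close> is the covariant derivative of \<open>Y\<close> in direction \<open>X\<close>; only its values
  on smooth vector fields matter.\<close>

definition affine_connection ::
  "('a, 'e::euclidean_space) chart set \<Rightarrow> ('a vfield \<Rightarrow> 'a vfield \<Rightarrow> 'a vfield) \<Rightarrow> bool" where
  "affine_connection A D \<longleftrightarrow>
     (\<forall>X Y. vector_field A X \<longrightarrow> vector_field A Y \<longrightarrow> vector_field A (D X Y)) \<and>
     (\<forall>X Y Z. vector_field A X \<longrightarrow> vector_field A Y \<longrightarrow> vector_field A Z \<longrightarrow>
        D (X + Y) Z = D X Z + D Y Z \<and> D X (Y + Z) = D X Y + D X Z) \<and>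
     (\<forall>f X Y. smooth_fun A f \<longrightarrow> vector_field A X \<longrightarrow> vector_field A Y \<longrightarrow>
        D (\<lambda>p. f p *\<^sub>R X p) Y = (\<lambda>p. f p *\<^sub>R D X Y p) \<and>
        D X (\<lambda>p. f p *\<^sub>R Y p) = (\<lambda>p. X p f *\<^sub>R Y p + f p *\<^sub>R D X Y p))"

definition levi_civita ::
  "('a, 'e::euclidean_space) chart set \<Rightarrow> 'a bilin_field \<Rightarrow>
   ('a vfield \<Rightarrow> 'a vfield \<Rightarrow> 'a vfield) \<Rightarrow> bool" where
  "levi_civita A g D \<longleftrightarrow>
     affine_connection A D \<and>
     (\<forall>X Y. vector_field A X \<longrightarrow> vector_field A Y \<longrightarrow> D X Y - D Y X = lie_bracket X Y) \<and>
     (\<forall>X Y Z p. vector_field A X \<longrightarrow> vector_field A Y \<longrightarrow> vector_field A Z \<longrightarrow>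
        X p (\<lambda>q. g q (Y q) (Z q)) = g p (D X Y p) (Z p) + g p (Y p) (D X Z p))"


section \<open>Curvature and structure tensors, evaluated on vector fields\<close>

definition curv ::
  "('a vfield \<Rightarrow> 'a vfield \<Rightarrow> 'a vfield) \<Rightarrow> 'a vfield \<Rightarrow> 'a vfield \<Rightarrow> 'a vfield \<Rightarrow> 'a vfield" where
  "curv D X Y Z = D X (D Y Z) - D Y (D X Z) - D (lie_bracket X Y) Z"

definition nabla_curv ::
  "('a vfield \<Rightarrow> 'a vfield \<Rightarrow> 'a vfield) \<Rightarrow>
   'a vfield \<Rightarrow> 'a vfield \<Rightarrow> 'a vfield \<Rightarrow> 'a vfield \<Rightarrow> 'a vfield" where
  "nabla_curv D V X Y Z =
     D V (curv D X Y Z) - curv D (D V X) Y Z - curv D X (D V Y) Z - curv D X Y (D V Z)"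

definition riem ::
  "'a bilin_field \<Rightarrow> ('a vfield \<Rightarrow> 'a vfield \<Rightarrow> 'a vfield) \<Rightarrow>
   'a vfield \<Rightarrow> 'a vfield \<Rightarrow> 'a vfield \<Rightarrow> 'a vfield \<Rightarrow> 'a \<Rightarrow> real" where
  "riem g D X Y Z W p = g p (curv D X Y Z p) (W p)"

definition pi1 ::
  "'a bilin_field \<Rightarrow> 'a vfield \<Rightarrow> 'a vfield \<Rightarrow> 'a vfield \<Rightarrow> 'a vfield \<Rightarrow> 'a \<Rightarrow> real" where
  "pi1 g X Y Z W p = g p (Y p) (Z p) * g p (X p) (W p) - g p (X p) (Z p) * g p (Y p) (W p)"

definition sectional_curvature ::
  "'a bilin_field \<Rightarrow> ('a vfield \<Rightarrow> 'a vfield \<Rightarrow> 'a vfield) \<Rightarrow>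
   'a vfield \<Rightarrow> 'a vfield \<Rightarrow> 'a \<Rightarrow> real" where
  "sectional_curvature g D X Y p = riem g D X Y Y X p / pi1 g X Y Y X p"

text \<open>Traces are taken with respect to a basis \<open>(E i p)\<close> of the tangent space at \<open>p\<close>,
  given by smooth vector fields \<open>E i\<close> (every basis at \<open>p\<close> extends to such fields).
  Basis independence is not built in: statements quantify over all such \<open>E\<close>.\<close>

definition frame_at ::
  "('a, 'e::euclidean_space) chart set \<Rightarrow> 'a \<Rightarrow> ('i \<Rightarrow> 'a vfield) \<Rightarrow> bool" where
  "frame_at A p E \<longleftrightarrow> (\<forall>i. vector_field A (E i)) \<and> tangent_basis A p (\<lambda>i. E i p)"

definition ginv :: "'a bilin_field \<Rightarrow> ('i::finite \<Rightarrow> 'a vfield) \<Rightarrow> 'a \<Rightarrow> real ^ 'i ^ 'i" where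
  "ginv g E p = matrix_inv (\<chi> i j. g p (E i p) (E j p))"

definition ricci ::
  "'a bilin_field \<Rightarrow> ('a vfield \<Rightarrow> 'a vfield \<Rightarrow> 'a vfield) \<Rightarrow> ('i::finite \<Rightarrow> 'a vfield) \<Rightarrow>
   'a vfield \<Rightarrow> 'a vfield \<Rightarrow> 'a \<Rightarrow> real" where
  "ricci g D E Y Z p = (\<Sum>i\<in>UNIV. \<Sum>j\<in>UNIV. ginv g E p $ i $ j * riem g D (E i) Y Z (E j) p)"

definition scalar_curvature ::
  "'a bilin_field \<Rightarrow> ('a vfield \<Rightarrow> 'a vfield \<Rightarrow> 'a vfield) \<Rightarrow> ('i::finite \<Rightarrow> 'a vfield) \<Rightarrow>
   'a \<Rightarrow> real" where
  "scalar_curvature g D E p =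
     (\<Sum>i\<in>UNIV. \<Sum>j\<in>UNIV. ginv g E p $ i $ j * ricci g D E (E i) (E j) p)"

definition psi1_ricci ::
  "'a bilin_field \<Rightarrow> ('a vfield \<Rightarrow> 'a vfield \<Rightarrow> 'a vfield) \<Rightarrow> ('i::finite \<Rightarrow> 'a vfield) \<Rightarrow>
   'a vfield \<Rightarrow> 'a vfield \<Rightarrow> 'a vfield \<Rightarrow> 'a vfield \<Rightarrow> 'a \<Rightarrow> real" where
  "psi1_ricci g D E X Y Z W p =
     g p (Y p) (Z p) * ricci g D E X W p - g p (X p) (Z p) * ricci g D E Y W p
     + ricci g D E Y Z p * g p (X p) (W p) - ricci g D E X Z p * g p (Y p) (W p)"

text \<open>The coefficients are those for dimension 4, hence the index type of the frame.\<close>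

definition weyl4 ::
  "'a bilin_field \<Rightarrow> ('a vfield \<Rightarrow> 'a vfield \<Rightarrow> 'a vfield) \<Rightarrow> (4 \<Rightarrow> 'a vfield) \<Rightarrow>
   'a vfield \<Rightarrow> 'a vfield \<Rightarrow> 'a vfield \<Rightarrow> 'a vfield \<Rightarrow> 'a \<Rightarrow> real" where
  "weyl4 g D E X Y Z W p =
     riem g D X Y Z W p
     - 1 / 2 * (psi1_ricci g D E X Y Z W p - scalar_curvature g D E p / 3 * pi1 g X Y Z W p)"

definition nabla_endo ::
  "('a vfield \<Rightarrow> 'a vfield \<Rightarrow> 'a vfield) \<Rightarrow> 'a endo_field \<Rightarrow> 'a vfield \<Rightarrow> 'a vfield \<Rightarrow> 'a vfield" where
  "nabla_endo D P X Y = D X (app_endo P Y) - app_endo P (D X Y)"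

definition F_tensor ::
  "'a bilin_field \<Rightarrow> ('a vfield \<Rightarrow> 'a vfield \<Rightarrow> 'a vfield) \<Rightarrow> 'a endo_field \<Rightarrow>
   'a vfield \<Rightarrow> 'a vfield \<Rightarrow> 'a vfield \<Rightarrow> 'a \<Rightarrow> real" where
  "F_tensor g D P X Y Z p = g p (nabla_endo D P X Y p) (Z p)"

definition nijenhuis :: "'a endo_field \<Rightarrow> 'a vfield \<Rightarrow> 'a vfield \<Rightarrow> 'a vfield" where
  "nijenhuis P X Y =
     lie_bracket X Y + lie_bracket (app_endo P X) (app_endo P Y)
     - app_endo P (lie_bracket (app_endo P X) Y) - app_endo P (lie_bracket X (app_endo P Y))"

definition nijenhuis_norm2 ::
  "'a bilin_field \<Rightarrow> 'a endo_field \<Rightarrow> ('i::finite \<Rightarrow> 'a vfield) \<Rightarrow> 'a \<Rightarrow> real" where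
  "nijenhuis_norm2 g P E p =
     (\<Sum>i\<in>UNIV. \<Sum>j\<in>UNIV. \<Sum>k\<in>UNIV. \<Sum>s\<in>UNIV.
        ginv g E p $ i $ j * ginv g E p $ k $ s *
        g p (nijenhuis P (E i) (E k) p) (nijenhuis P (E j) (E s) p))"

definition nabla_endo_norm2 ::
  "'a bilin_field \<Rightarrow> ('a vfield \<Rightarrow> 'a vfield \<Rightarrow> 'a vfield) \<Rightarrow> 'a endo_field \<Rightarrow>
   ('i::finite \<Rightarrow> 'a vfield) \<Rightarrow> 'a \<Rightarrow> real" where
  "nabla_endo_norm2 g D P E p =
     (\<Sum>i\<in>UNIV. \<Sum>j\<in>UNIV. \<Sum>k\<in>UNIV. \<Sum>s\<in>UNIV.
        ginv g E p $ i $ j * ginv g E p $ k $ s *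
        g p (nabla_endo D P (E i) (E k) p) (nabla_endo D P (E j) (E s) p))"


section \<open>Classes of metrics and manifolds\<close>

definition locally_symmetric ::
  "('a, 'e::euclidean_space) chart set \<Rightarrow> ('a vfield \<Rightarrow> 'a vfield \<Rightarrow> 'a vfield) \<Rightarrow> bool" where
  "locally_symmetric A D \<longleftrightarrow>
     (\<forall>V X Y Z. vector_field A V \<longrightarrow> vector_field A X \<longrightarrow> vector_field A Y \<longrightarrow> vector_field A Z \<longrightarrow>
        nabla_curv D V X Y Z = 0)"

definition W3_manifold ::
  "('a, 'e::euclidean_space) chart set \<Rightarrow> 'a bilin_field \<Rightarrow>
   ('a vfield \<Rightarrow> 'a vfield \<Rightarrow> 'a vfield) \<Rightarrow> 'a endo_field \<Rightarrow> bool" where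
  "W3_manifold A g D P \<longleftrightarrow>
     (\<forall>X Y Z p. vector_field A X \<longrightarrow> vector_field A Y \<longrightarrow> vector_field A Z \<longrightarrow>
        F_tensor g D P X Y Z p + F_tensor g D P Y Z X p + F_tensor g D P Z X Y p = 0)"

definition killing_metric ::
  "('a, 'e::euclidean_space) chart set \<Rightarrow> ('a \<Rightarrow> 'a \<Rightarrow> 'a) \<Rightarrow> 'a bilin_field \<Rightarrow> bool" where
  "killing_metric A mul g \<longleftrightarrow>
     (\<forall>X Y Z p. left_invariant A mul X \<longrightarrow> left_invariant A mul Y \<longrightarrow> left_invariant A mul Z \<longrightarrow>
        g p (lie_bracket X Y p) (Z p) + g p (lie_bracket X Z p) (Y p) = 0)"

definition weyl_zero ::
  "('a, 'e::euclidean_space) chart set \<Rightarrow> 'a bilin_field \<Rightarrow>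
   ('a vfield \<Rightarrow> 'a vfield \<Rightarrow> 'a vfield) \<Rightarrow> bool" where
  "weyl_zero A g D \<longleftrightarrow>
     (\<forall>p E X Y Z W. frame_at A p E \<longrightarrow>
        vector_field A X \<longrightarrow> vector_field A Y \<longrightarrow> vector_field A Z \<longrightarrow> vector_field A W \<longrightarrow>
        weyl4 g D E X Y Z W p = 0)"

text \<open>The index tuples obtained from \<open>(i, j, k, s)\<close> by antisymmetry in each pair and by the
  pair exchange, i.e. the positions determined by one curvature component.\<close>

definition riem_orbit :: "'i \<Rightarrow> 'i \<Rightarrow> 'i \<Rightarrow> 'i \<Rightarrow> ('i \<times> 'i \<times> 'i \<times> 'i) set" where
  "riem_orbit i j k s =
     {(i, j, k, s), (j, i, k, s), (i, j, s, k), (j, i, s, k),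
      (k, s, i, j), (k, s, j, i), (s, k, i, j), (s, k, j, i)}"

end

theory Submission
  imports Defs
begin

text \<open>The structure constants \<open>c i j k = g([X\<^sub>i, X\<^sub>j], X\<^sub>k)\<close> are totally skew, so Koszul's formula
  gives \<open>\<nabla>\<^bsub>X\<^esub>Y = [X, Y] / 2\<close> for left-invariant fields and the Jacobi identity gives
  \<open>R(X, Y)Z = -[[X, Y], Z] / 4\<close> and \<open>\<nabla>R = 0\<close>. In dimension 4 a skew \<open>c\<close> is dual to a vector \<open>w\<close>,
  in terms of which the curvature is \<open>\<bar>w\<bar>\<^sup>2 \<pi>\<^sub>1\<close> minus the \<open>\<psi>\<^sub>1\<close> of \<open>w \<otimes> w\<close>, divided by 4; in
  particular \<open>R\<close> is recovered from \<open>\<rho> = (\<bar>w\<bar>\<^sup>2 g - w \<otimes> w) / 2\<close> and \<open>W = 0\<close>. All other claims are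
  evaluated on the frame \<open>X\<^sub>i\<close>, which suffices because the expressions are tensorial and the
  traces do not depend on the basis.\<close>

subsection \<open>Smooth functions\<close>

text \<open>\<open>curv\<close>, \<open>ricci\<close>, \<open>F_tensor\<close> and the rest take
  vector fields on the whole manifold as arguments, and \<open>D\<close> is constrained on such
  fields only. Passing to values on the frame is therefore linearity over smooth functions: the
  left-invariant frame is global, the coefficients g(V, X_i) are smooth everywhere, and no cut-off
  functions or localisation occur. Charts serve only to show that constants, sums and products of
  smooth functions are smooth; from there on vector fields are treated as derivations. Geometrically
  w explains the curvature: it is central, and on its orthogonal complement the bracket is |w| times
  a cross product. For nonzero w the group is thus locally the Riemannian product of a line and a
  3-sphere of curvature |w|^2 / 4, which is locally symmetric and conformally flat.\<close>

lemma Ck_on_cong: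
  assumes "open S" "\<And>x. x \<in> S \<Longrightarrow> f x = h x" "Ck_on n S f"
  shows "Ck_on n S h"
  using assms(2,3)
proof (induction n arbitrary: f h)
  case 0
  then show ?case using continuous_on_cong[of S S f h] by simp
next
  case (Suc n)
  have der: "(h has_derivative frechet_derivative f (at x)) (at x)" if "x \<in> S" for x
  proof -
    have "(f has_derivative frechet_derivative f (at x)) (at x)"
      using Suc.prems that by (simp add: frechet_derivative_works)
    then show ?thesis
      using has_derivative_transform_within_open[OF _ assms(1) that] Suc.prems(1) by blast
  qed
  have "Ck_on n S (\<lambda>x. frechet_derivative h (at x) v)" for v
  proof (rule Suc.IH)
    show "Ck_on n S (\<lambda>x. frechet_derivative f (at x) v)" using Suc.prems by simp
    show "frechet_derivative f (at x) v = frechet_derivative h (at x) v" if "x \<in> S" for x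
      using frechet_derivative_at[OF der[OF that]] by simp
  qed
  then show ?case using der by (auto simp: differentiable_def)
qed

lemma Ck_on_SucD: "Ck_on (Suc n) S f \<Longrightarrow> Ck_on n S f"
proof (induction n arbitrary: f)
  case 0
  then show ?case
    by (auto intro!: continuous_at_imp_continuous_on differentiable_imp_continuous_within)
next
  case (Suc n)
  then show ?case by (metis Ck_on.simps(2))
qed

lemma Ck_on_add:
  assumes "open S" "Ck_on n S f" "Ck_on n S h"
  shows "Ck_on n S (\<lambda>x. f x + h x)"
  using assms(2,3)
proof (induction n arbitrary: f h)
  case 0
  then show ?case by (simp add: continuous_on_add)
next
  case (Suc n)
  have der: "((\<lambda>x. f x + h x) has_derivative
      (\<lambda>v. frechet_derivative f (at x) v + frechet_derivative h (at x) v)) (at x)"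
    if "x \<in> S" for x
    by (rule has_derivative_add; use Suc.prems that in \<open>simp add: frechet_derivative_works[symmetric]\<close>)
  have "Ck_on n S (\<lambda>x. frechet_derivative (\<lambda>x. f x + h x) (at x) v)" for v
  \<comment> \<open>The sum rule identifies the derivative only at points of \<open>S\<close>;
    elsewhere \<open>frechet_derivative\<close> may be an arbitrary choice, so the two functions are
    compared on \<open>S\<close> alone.\<close>
  proof (rule Ck_on_cong[OF assms(1)])
    show "Ck_on n S (\<lambda>x. frechet_derivative f (at x) v + frechet_derivative h (at x) v)"
      using Suc.prems by (intro Suc.IH) auto
    show "frechet_derivative f (at x) v + frechet_derivative h (at x) v =
        frechet_derivative (\<lambda>x. f x + h x) (at x) v" if "x \<in> S" for x
      using frechet_derivative_at[OF der[OF that]] by metis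
  qed
  then show ?case using der by (auto simp: differentiable_def)
qed

text \<open>The derivative of a product contains the factors themselves, so the induction hypothesis
  at level \<open>n\<close> is needed for \<open>f\<close> and \<open>h\<close> as well as for their
  derivatives; \<open>Ck_on_SucD\<close> lowers them to that level.\<close>

lemma Ck_on_mult:
  fixes f h :: "'e::real_normed_vector \<Rightarrow> 'f::real_normed_algebra"
  assumes "open S" "Ck_on n S f" "Ck_on n S h"
  shows "Ck_on n S (\<lambda>x. f x * h x)"
  using assms(2,3)
proof (induction n arbitrary: f h)
  case 0
  then show ?case by (simp add: continuous_on_mult)
next
  case (Suc n)
  have der: "((\<lambda>x. f x * h x) has_derivative
      (\<lambda>v. f x * frechet_derivative h (at x) v + frechet_derivative f (at x) v * h x)) (at x)"
    if "x \<in> S" for x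
    by (rule has_derivative_mult; use Suc.prems that in \<open>simp add: frechet_derivative_works[symmetric]\<close>)
  have "Ck_on n S (\<lambda>x. frechet_derivative (\<lambda>x. f x * h x) (at x) v)" for v
  proof (rule Ck_on_cong[OF assms(1)])
    show "Ck_on n S (\<lambda>x. f x * frechet_derivative h (at x) v + frechet_derivative f (at x) v * h x)"
      using Suc.prems Ck_on_SucD[OF Suc.prems(1)] Ck_on_SucD[OF Suc.prems(2)]
      by (intro Ck_on_add[OF assms(1)] Suc.IH) auto
    show "f x * frechet_derivative h (at x) v + frechet_derivative f (at x) v * h x =
        frechet_derivative (\<lambda>x. f x * h x) (at x) v" if "x \<in> S" for x
      using frechet_derivative_at[OF der[OF that]] by metis
  qed
  then show ?case using der by (auto simp: differentiable_def)
qed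

lemma Ck_on_const: "Ck_on n S (\<lambda>x. c)"
  by (induction n arbitrary: c) (simp_all add: frechet_derivative_const)

lemma smooth_on_add:
  "open S \<Longrightarrow> smooth_on S f \<Longrightarrow> smooth_on S h \<Longrightarrow> smooth_on S (\<lambda>x. f x + h x)"
  by (simp add: smooth_on_def Ck_on_add)

lemma smooth_on_mult:
  fixes f h :: "'e::real_normed_vector \<Rightarrow> 'f::real_normed_algebra"
  shows "open S \<Longrightarrow> smooth_on S f \<Longrightarrow> smooth_on S h \<Longrightarrow> smooth_on S (\<lambda>x. f x * h x)"
  by (simp add: smooth_on_def Ck_on_mult)

locale smooth_manifold =
  fixes A :: "('a::{t2_space,second_countable_topology}, 'e::euclidean_space) chart set"
  assumes atlas: "smooth_atlas A"
begin

lemma open_chart_image: "(U, \<phi>) \<in> A \<Longrightarrow> open (\<phi> ` U)"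
  using atlas unfolding smooth_atlas_def by auto

lemma smooth_fun_const [simp]: "smooth_fun A (\<lambda>_. c)"
  by (auto simp: smooth_fun_def smooth_on_def o_def Ck_on_const)

lemma smooth_fun_add: "smooth_fun A f \<Longrightarrow> smooth_fun A h \<Longrightarrow> smooth_fun A (f + h)"
  using smooth_on_add[OF open_chart_image] by (fastforce simp: smooth_fun_def o_def plus_fun_def)

lemma smooth_fun_mult: "smooth_fun A f \<Longrightarrow> smooth_fun A h \<Longrightarrow> smooth_fun A (f * h)"
  using smooth_on_mult[OF open_chart_image] by (fastforce simp: smooth_fun_def o_def times_fun_def)

lemma smooth_fun_add':
  "smooth_fun A f \<Longrightarrow> smooth_fun A h \<Longrightarrow> smooth_fun A (\<lambda>p. f p + h p)"
  using smooth_fun_add by (simp add: plus_fun_def)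

lemma smooth_fun_mult':
  "smooth_fun A f \<Longrightarrow> smooth_fun A h \<Longrightarrow> smooth_fun A (\<lambda>p. f p * h p)"
  using smooth_fun_mult by (simp add: times_fun_def)

end

subsection \<open>Vector fields\<close>

definition fscale :: "('a \<Rightarrow> real) \<Rightarrow> 'a vfield \<Rightarrow> 'a vfield"  (infixr "\<odot>" 75)
  where "f \<odot> X = (\<lambda>p. f p *\<^sub>R X p)"

lemma fscale_apply [simp]: "(f \<odot> X) p = f p *\<^sub>R X p"
  by (simp add: fscale_def)

lemma scaleR_fun_apply [simp]: "(c *\<^sub>R f) x = c *\<^sub>R f x"
  by (simp add: scaleR_fun_def)

lemma uminus_vfield: "- X = (\<lambda>_. -1) \<odot> X"
  by (simp add: fun_eq_iff)

lemma scaleR_vfield: "c *\<^sub>R X = (\<lambda>_. c) \<odot> X"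
  by (simp add: fun_eq_iff)

lemma lie_bracket_antisym: "lie_bracket Y X = - lie_bracket X Y"
  by (simp add: lie_bracket_def fun_eq_iff)

lemma lie_bracket_apply: "lie_bracket X Y p f = X p (\<lambda>q. Y q f) - Y p (\<lambda>q. X q f)"
  by (simp add: lie_bracket_def)

context smooth_manifold
begin

lemma tangent_space_subspace: "subspace (tangent_space A p)"
  unfolding subspace_def tangent_space_def by (auto simp: algebra_simps)

lemmas tangent_space_zero [simp] = subspace_0[OF tangent_space_subspace]
lemmas tangent_space_add [simp] = subspace_add[OF tangent_space_subspace]
lemmas tangent_space_scaleR [simp] = subspace_scale[OF tangent_space_subspace]
lemmas tangent_space_uminus [simp] = subspace_neg[OF tangent_space_subspace]
lemmas tangent_space_sum = subspace_sum[OF tangent_space_subspace]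

lemma vector_fieldI:
  "(\<And>p. X p \<in> tangent_space A p) \<Longrightarrow> (\<And>f. smooth_fun A (\<lambda>p. X p f)) \<Longrightarrow> vector_field A X"
  by (simp add: vector_field_def)

lemma vfield_tangent [simp]: "vector_field A X \<Longrightarrow> X p \<in> tangent_space A p"
  by (simp add: vector_field_def)

lemma vfield_nonsmooth: "vector_field A X \<Longrightarrow> \<not> smooth_fun A f \<Longrightarrow> X p f = 0"
  using vfield_tangent[of X p] by (simp add: tangent_space_def)

lemma vfield_plus:
  "vector_field A X \<Longrightarrow> smooth_fun A f \<Longrightarrow> smooth_fun A h \<Longrightarrow>
    X p (\<lambda>q. f q + h q) = X p f + X p h"
  using vfield_tangent[of X p] by (simp add: tangent_space_def plus_fun_def)

lemma vfield_times:
  "vector_field A X \<Longrightarrow> smooth_fun A f \<Longrightarrow> smooth_fun A h \<Longrightarrow>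
    X p (\<lambda>q. f q * h q) = f p * X p h + h p * X p f"
  using vfield_tangent[of X p] by (simp add: tangent_space_def times_fun_def)

lemma vfield_scaleR:
  "vector_field A X \<Longrightarrow> smooth_fun A f \<Longrightarrow> X p (\<lambda>q. c * f q) = c * X p f"
  using vfield_tangent[of X p] by (simp add: tangent_space_def scaleR_fun_def)

lemma vfield_const:
  assumes "vector_field A X"
  shows "X p (\<lambda>_. c) = 0"
proof -
  \<comment> \<open>The Leibniz rule for 1 * 1 gives X 1 = X 1 + X 1.\<close>
  have one: "X p (\<lambda>_. 1) = 0"
    using vfield_times[OF assms, of "\<lambda>_. 1" "\<lambda>_. 1" p] by simp
  show ?thesis
    using vfield_scaleR[OF assms smooth_fun_const, of p c 1] one by simp
qed

text \<open>Also for a non-smooth \<open>f\<close>, on which tangent vectors vanish by definition.\<close>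

lemma smooth_fun_vfield [simp]:
  assumes "vector_field A X"
  shows "smooth_fun A (\<lambda>p. X p f)"
proof (cases "smooth_fun A f")
  case True
  then show ?thesis using assms by (simp add: vector_field_def)
next
  case False
  then have "(\<lambda>p. X p f) = (\<lambda>_. 0)" using vfield_nonsmooth[OF assms] by (simp add: fun_eq_iff)
  then show ?thesis by simp
qed

lemma vfield_diff:
  assumes "vector_field A X" "smooth_fun A f" "smooth_fun A h"
  shows "X p (\<lambda>q. f q - h q) = X p f - X p h"
proof -
  have "X p (\<lambda>q. f q + (-1) * h q) = X p f + X p (\<lambda>q. (-1) * h q)"
    by (rule vfield_plus[OF assms(1,2)]) (rule smooth_fun_mult'[OF smooth_fun_const assms(3)])
  also have "X p (\<lambda>q. (-1) * h q) = - X p h"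
    using vfield_scaleR[OF assms(1,3), of p "-1"] by simp
  finally show ?thesis by simp
qed

lemma smooth_fun_diff:
  "smooth_fun A f \<Longrightarrow> smooth_fun A h \<Longrightarrow> smooth_fun A (\<lambda>p. f p - h p)"
  using smooth_fun_add'[of f "\<lambda>p. (-1) * h p"] smooth_fun_mult'[OF smooth_fun_const[of "-1"], of h]
  by simp

lemma vector_field_add [simp]:
  "vector_field A X \<Longrightarrow> vector_field A Y \<Longrightarrow> vector_field A (X + Y)"
  by (rule vector_fieldI) (simp_all add: smooth_fun_add')

lemma vector_field_fscale [simp]:
  "smooth_fun A f \<Longrightarrow> vector_field A X \<Longrightarrow> vector_field A (f \<odot> X)"
  by (rule vector_fieldI) (simp_all add: smooth_fun_mult')

lemma vector_field_zero [simp]: "vector_field A 0"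
  by (rule vector_fieldI) simp_all

lemma vector_field_scaleR [simp]: "vector_field A X \<Longrightarrow> vector_field A (c *\<^sub>R X)"
  by (simp add: scaleR_vfield)

lemma vector_field_uminus [simp]: "vector_field A X \<Longrightarrow> vector_field A (- X)"
  by (simp add: uminus_vfield)

lemma vector_field_diff [simp]:
  "vector_field A X \<Longrightarrow> vector_field A Y \<Longrightarrow> vector_field A (X - Y)"
  using vector_field_add[of X "- Y"] by simp

lemma vector_field_sum [simp]:
  "(\<And>i. i \<in> I \<Longrightarrow> vector_field A (X i)) \<Longrightarrow> vector_field A (sum X I)"
  by (induction I rule: infinite_finite_induct) simp_all

lemma lie_bracket_vector_field [simp]:
  assumes X: "vector_field A X" and Y: "vector_field A Y"
  shows "vector_field A (lie_bracket X Y)"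
proof -
  \<comment> \<open>For a non-smooth \<open>f\<close> the inner functions \<open>Y q f\<close> and
    \<open>X q f\<close> are constantly 0, so the bracket vanishes by \<open>vfield_const\<close>;
    for smooth arguments the mixed first-order products cancel in the Leibniz rule.\<close>
  note rules = vfield_plus[OF X] vfield_plus[OF Y] vfield_times[OF X] vfield_times[OF Y]
    vfield_scaleR[OF X] vfield_scaleR[OF Y] vfield_nonsmooth[OF X] vfield_nonsmooth[OF Y]
    vfield_const[OF X] vfield_const[OF Y] smooth_fun_vfield[OF X] smooth_fun_vfield[OF Y]
  have "lie_bracket X Y p \<in> tangent_space A p" for p
    by (auto simp: tangent_space_def lie_bracket_def plus_fun_def times_fun_def
        scaleR_fun_def rules smooth_fun_mult' algebra_simps)
  moreover have "smooth_fun A (\<lambda>p. lie_bracket X Y p f)" for f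
    by (simp add: lie_bracket_def smooth_fun_diff smooth_fun_vfield[OF X] smooth_fun_vfield[OF Y])
  ultimately show ?thesis by (rule vector_fieldI)
qed

lemma lie_bracket_add_right:
  assumes "vector_field A X" "vector_field A Y" "vector_field A Z"
  shows "lie_bracket X (Y + Z) = lie_bracket X Y + lie_bracket X Z"
  using assms by (simp add: lie_bracket_def fun_eq_iff vfield_plus[OF assms(1)])

lemma lie_bracket_add_left:
  assumes "vector_field A X" "vector_field A Y" "vector_field A Z"
  shows "lie_bracket (X + Y) Z = lie_bracket X Z + lie_bracket Y Z"
  using assms by (simp add: lie_bracket_def fun_eq_iff vfield_plus[OF assms(3)])

lemma lie_bracket_fscale_right:
  assumes "smooth_fun A f" "vector_field A X" "vector_field A Y"
  shows "lie_bracket X (f \<odot> Y) = (\<lambda>p. X p f) \<odot> Y + f \<odot> lie_bracket X Y"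
  using assms by (simp add: lie_bracket_def fun_eq_iff vfield_times[OF assms(2)] algebra_simps)

lemma lie_bracket_fscale_left:
  assumes "smooth_fun A f" "vector_field A X" "vector_field A Y"
  shows "lie_bracket (f \<odot> X) Y = f \<odot> lie_bracket X Y - (\<lambda>p. Y p f) \<odot> X"
  using assms by (simp add: lie_bracket_def fun_eq_iff vfield_times[OF assms(3)] algebra_simps)

lemma lie_bracket_scaleR:
  assumes "vector_field A X" "vector_field A Y"
  shows "lie_bracket (r *\<^sub>R X) Y = r *\<^sub>R lie_bracket X Y"
    and "lie_bracket X (r *\<^sub>R Y) = r *\<^sub>R lie_bracket X Y"
  using assms
  by (simp_all add: scaleR_vfield lie_bracket_fscale_left lie_bracket_fscale_right vfield_const
      fun_eq_iff)

text \<open>Stated as the Leibniz rule for the operator [X, _], the form in which the curvature and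
  its covariant derivative use it. Both sides expand to the same threefold compositions.\<close>

lemma lie_bracket_jacobi:
  assumes "vector_field A X" "vector_field A Y" "vector_field A Z"
  shows "lie_bracket X (lie_bracket Y Z) =
    lie_bracket (lie_bracket X Y) Z + lie_bracket Y (lie_bracket X Z)"
  using assms
  by (simp add: fun_eq_iff lie_bracket_apply vfield_diff[OF assms(1)] vfield_diff[OF assms(2)]
      vfield_diff[OF assms(3)])

text \<open>Linearity over smooth functions comes in two versions: \<open>tensorial\<close> for
  operators between fields, and \<open>tensorial_at\<close> for real values at one point
  \<open>p\<close>, where a coefficient function acts through \<open>f p\<close>. The second suits
  traces, whose basis need only be one at \<open>p\<close>.\<close>

definition tensorial :: "('a vfield \<Rightarrow> 'a vfield) \<Rightarrow> bool" where
  "tensorial T \<longleftrightarrow>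
     (\<forall>X. vector_field A X \<longrightarrow> vector_field A (T X)) \<and>
     (\<forall>X Y. vector_field A X \<longrightarrow> vector_field A Y \<longrightarrow> T (X + Y) = T X + T Y) \<and>
     (\<forall>f X. smooth_fun A f \<longrightarrow> vector_field A X \<longrightarrow> T (f \<odot> X) = f \<odot> T X)"

definition tensorial_at :: "'a \<Rightarrow> ('a vfield \<Rightarrow> real) \<Rightarrow> bool" where
  "tensorial_at p T \<longleftrightarrow>
     (\<forall>X Y. vector_field A X \<longrightarrow> vector_field A Y \<longrightarrow> T (X + Y) = T X + T Y) \<and>
     (\<forall>f X. smooth_fun A f \<longrightarrow> vector_field A X \<longrightarrow> T (f \<odot> X) = f p * T X)"

lemma tensorial_at_add:
  "tensorial_at p S \<Longrightarrow> tensorial_at p T \<Longrightarrow> tensorial_at p (\<lambda>X. S X + T X)"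
  by (simp add: tensorial_at_def algebra_simps)

lemma tensorial_at_diff:
  "tensorial_at p S \<Longrightarrow> tensorial_at p T \<Longrightarrow> tensorial_at p (\<lambda>X. S X - T X)"
  by (simp add: tensorial_at_def algebra_simps)

lemma tensorial_at_cmult: "tensorial_at p T \<Longrightarrow> tensorial_at p (\<lambda>X. c * T X)"
  by (simp add: tensorial_at_def algebra_simps)

lemma tensorial_at_cmult_right: "tensorial_at p T \<Longrightarrow> tensorial_at p (\<lambda>X. T X * c)"
  by (simp add: tensorial_at_def algebra_simps)

lemma tensorial_at_sum:
  "(\<And>i. i \<in> I \<Longrightarrow> tensorial_at p (T i)) \<Longrightarrow> tensorial_at p (\<lambda>X. \<Sum>i\<in>I. T i X)"
  by (simp add: tensorial_at_def sum.distrib sum_distrib_left)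

lemma tensorial_at_vsum:
  assumes "tensorial_at p T" "\<And>i. i \<in> I \<Longrightarrow> vector_field A (X i)"
  shows "T (\<Sum>i\<in>I. X i) = (\<Sum>i\<in>I. T (X i))"
proof -
  have "T 0 = 0"
    using assms(1) vector_field_zero smooth_fun_const[of 0]
    unfolding tensorial_at_def by (metis add_cancel_left_left add_0)
  then show ?thesis
    using assms by (induction I rule: infinite_finite_induct) (simp_all add: tensorial_at_def)
qed

end

subsection \<open>Tensoriality of curvature and structure tensors\<close>

locale affine_manifold = smooth_manifold A
  for A :: "('a::{t2_space,second_countable_topology}, 'e::euclidean_space) chart set" +
  fixes D :: "'a vfield \<Rightarrow> 'a vfield \<Rightarrow> 'a vfield"
  assumes affine: "affine_connection A D"
begin

lemma D_vector_field [simp]: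
  "vector_field A X \<Longrightarrow> vector_field A Y \<Longrightarrow> vector_field A (D X Y)"
  using affine by (simp add: affine_connection_def)

lemma D_add_left:
  "vector_field A X \<Longrightarrow> vector_field A Y \<Longrightarrow> vector_field A Z \<Longrightarrow> D (X + Y) Z = D X Z + D Y Z"
  using affine by (simp add: affine_connection_def)

lemma D_add_right:
  "vector_field A X \<Longrightarrow> vector_field A Y \<Longrightarrow> vector_field A Z \<Longrightarrow> D X (Y + Z) = D X Y + D X Z"
  using affine by (simp add: affine_connection_def)

lemma D_fscale_left:
  "smooth_fun A f \<Longrightarrow> vector_field A X \<Longrightarrow> vector_field A Y \<Longrightarrow> D (f \<odot> X) Y = f \<odot> D X Y"
  using affine unfolding affine_connection_def fscale_def by blast

lemma D_fscale_right:
  assumes "smooth_fun A f" "vector_field A X" "vector_field A Y"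
  shows "D X (f \<odot> Y) = (\<lambda>p. X p f) \<odot> Y + f \<odot> D X Y"
proof -
  have "D X (f \<odot> Y) = (\<lambda>p. X p f *\<^sub>R Y p + f p *\<^sub>R D X Y p)"
    using affine assms unfolding affine_connection_def fscale_def by blast
  then show ?thesis by (simp add: fun_eq_iff)
qed

lemma D_scaleR_left:
  "vector_field A X \<Longrightarrow> vector_field A Y \<Longrightarrow> D (c *\<^sub>R X) Y = c *\<^sub>R D X Y"
  by (simp add: scaleR_vfield D_fscale_left)

lemma D_scaleR_right:
  "vector_field A X \<Longrightarrow> vector_field A Y \<Longrightarrow> D X (c *\<^sub>R Y) = c *\<^sub>R D X Y"
  by (simp add: scaleR_vfield D_fscale_right vfield_const fun_eq_iff)

lemma D_diff_left:
  "vector_field A X \<Longrightarrow> vector_field A Y \<Longrightarrow> vector_field A Z \<Longrightarrow> D (X - Y) Z = D X Z - D Y Z"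
  using D_add_left[of X "- Y" Z] D_scaleR_left[of Y Z "-1"] by simp

lemma D_diff_right:
  "vector_field A X \<Longrightarrow> vector_field A Y \<Longrightarrow> vector_field A Z \<Longrightarrow> D X (Y - Z) = D X Y - D X Z"
  using D_add_right[of X Y "- Z"] D_scaleR_right[of X Z "-1"] by simp

lemma D_zero_left: "vector_field A X \<Longrightarrow> D 0 X = 0"
  using D_scaleR_left[of 0 X 0] by simp

lemma D_zero_right: "vector_field A X \<Longrightarrow> D X 0 = 0"
  using D_scaleR_right[of X 0 0] by simp

lemma D_sum_left:
  "(\<And>i. i \<in> I \<Longrightarrow> vector_field A (X i)) \<Longrightarrow> vector_field A Y \<Longrightarrow>
    D (\<Sum>i\<in>I. X i) Y = (\<Sum>i\<in>I. D (X i) Y)"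
  by (induction I rule: infinite_finite_induct) (simp_all add: D_zero_left D_add_left)

lemma D_sum_right:
  "(\<And>i. i \<in> I \<Longrightarrow> vector_field A (X i)) \<Longrightarrow> vector_field A Y \<Longrightarrow>
    D Y (\<Sum>i\<in>I. X i) = (\<Sum>i\<in>I. D Y (X i))"
  by (induction I rule: infinite_finite_induct) (simp_all add: D_zero_right D_add_right)

lemmas D_simps = D_add_left D_add_right D_fscale_left D_fscale_right D_diff_left D_diff_right

lemma curv_vector_field [simp]:
  "vector_field A X \<Longrightarrow> vector_field A Y \<Longrightarrow> vector_field A Z \<Longrightarrow> vector_field A (curv D X Y Z)"
  by (simp add: curv_def)

lemma nabla_curv_vector_field [simp]:
  "vector_field A V \<Longrightarrow> vector_field A X \<Longrightarrow> vector_field A Y \<Longrightarrow> vector_field A Z \<Longrightarrow>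
    vector_field A (nabla_curv D V X Y Z)"
  by (simp add: nabla_curv_def)

lemma curv_antisym:
  assumes "vector_field A X" "vector_field A Y" "vector_field A Z"
  shows "curv D Y X Z = - curv D X Y Z"
  using D_scaleR_left[of "lie_bracket X Y" Z "-1"] assms
  by (simp add: curv_def lie_bracket_antisym[of Y X])

context
  fixes V X Y Z :: "'a vfield"
  assumes vf [simp]: "vector_field A V" "vector_field A X" "vector_field A Y" "vector_field A Z"
begin

lemma curv_add_1:
  assumes "vector_field A W"
  shows "curv D (X + W) Y Z = curv D X Y Z + curv D W Y Z"
  using assms by (simp add: curv_def D_simps lie_bracket_add_left)

lemma curv_fscale_1:
  assumes "smooth_fun A f"
  shows "curv D (f \<odot> X) Y Z = f \<odot> curv D X Y Z"
  using assms by (simp add: curv_def D_simps lie_bracket_fscale_left fun_eq_iff algebra_simps)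

lemma curv_add_3:
  assumes "vector_field A W"
  shows "curv D X Y (Z + W) = curv D X Y Z + curv D X Y W"
  using assms by (simp add: curv_def D_simps)

text \<open>Second derivatives of \<open>f\<close> appear only as X(Y f) - Y(X f) - [X, Y] f = 0,
  which is the purpose of the bracket term in \<open>curv\<close>.\<close>

lemma curv_fscale_3:
  assumes "smooth_fun A f"
  shows "curv D X Y (f \<odot> Z) = f \<odot> curv D X Y Z"
  using assms by (simp add: curv_def D_simps fun_eq_iff lie_bracket_apply algebra_simps)

end

lemma curv_add_2:
  assumes "vector_field A X" "vector_field A Y" "vector_field A Z" "vector_field A W"
  shows "curv D X (Y + W) Z = curv D X Y Z + curv D X W Z"
  using assms by (simp add: curv_antisym[of _ X] curv_add_1)

lemma curv_fscale_2:
  assumes "vector_field A X" "vector_field A Y" "vector_field A Z" "smooth_fun A f"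
  shows "curv D X (f \<odot> Y) Z = f \<odot> curv D X Y Z"
  using assms by (simp add: curv_antisym[of _ X] curv_fscale_1 fun_eq_iff)

lemmas curv_simps = curv_add_1 curv_add_2 curv_add_3 curv_fscale_1 curv_fscale_2 curv_fscale_3

lemma tensorial_curv:
  "vector_field A Y \<Longrightarrow> vector_field A Z \<Longrightarrow> tensorial (\<lambda>X. curv D X Y Z)"
  "vector_field A X \<Longrightarrow> vector_field A Z \<Longrightarrow> tensorial (\<lambda>Y. curv D X Y Z)"
  "vector_field A X \<Longrightarrow> vector_field A Y \<Longrightarrow> tensorial (\<lambda>Z. curv D X Y Z)"
  by (simp_all add: tensorial_def curv_simps)

text \<open>In the slots of \<open>X\<close>, \<open>Y\<close>, \<open>Z\<close> the term V f
  produced by differentiating the curvature is cancelled by the one from the covariant derivative of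
  that argument.\<close>

lemma tensorial_nabla_curv:
  "vector_field A X \<Longrightarrow> vector_field A Y \<Longrightarrow> vector_field A Z \<Longrightarrow> tensorial (\<lambda>V. nabla_curv D V X Y Z)"
  "vector_field A V \<Longrightarrow> vector_field A Y \<Longrightarrow> vector_field A Z \<Longrightarrow> tensorial (\<lambda>X. nabla_curv D V X Y Z)"
  "vector_field A V \<Longrightarrow> vector_field A X \<Longrightarrow> vector_field A Z \<Longrightarrow> tensorial (\<lambda>Y. nabla_curv D V X Y Z)"
  "vector_field A V \<Longrightarrow> vector_field A X \<Longrightarrow> vector_field A Y \<Longrightarrow> tensorial (\<lambda>Z. nabla_curv D V X Y Z)"
  by (simp_all add: tensorial_def nabla_curv_def curv_simps D_simps fun_eq_iff algebra_simps)

end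

text \<open>The endomorphism field is an involution in order that the Nijenhuis tensor, in the form
  with \<open>[X, Y]\<close> instead of \<open>P\<^sup>2[X, Y]\<close>, be tensorial.\<close>

locale almost_product_manifold = smooth_manifold A
  for A :: "('a::{t2_space,second_countable_topology}, 'e::euclidean_space) chart set" +
  fixes P :: "'a endo_field"
  assumes almost_product: "almost_product A P"
begin

lemma P_vector_field [simp]: "vector_field A X \<Longrightarrow> vector_field A (app_endo P X)"
  using almost_product by (simp add: almost_product_def tensor_field_1_1_def)

lemma P_involution: "vector_field A X \<Longrightarrow> app_endo P (app_endo P X) = X"
  using almost_product by (simp add: almost_product_def app_endo_def)

lemma P_add:
  "vector_field A X \<Longrightarrow> vector_field A Y \<Longrightarrow> app_endo P (X + Y) = app_endo P X + app_endo P Y"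
  using almost_product
  by (simp add: almost_product_def tensor_field_1_1_def app_endo_def plus_fun_def)

lemma P_fscale: "vector_field A X \<Longrightarrow> app_endo P (f \<odot> X) = f \<odot> app_endo P X"
  using almost_product
  by (simp add: almost_product_def tensor_field_1_1_def app_endo_def fun_eq_iff)

lemma P_scaleR: "vector_field A X \<Longrightarrow> app_endo P (c *\<^sub>R X) = c *\<^sub>R app_endo P X"
  by (simp add: scaleR_vfield P_fscale)

lemma P_diff:
  "vector_field A X \<Longrightarrow> vector_field A Y \<Longrightarrow> app_endo P (X - Y) = app_endo P X - app_endo P Y"
  using P_add[of X "- Y"] P_scaleR[of Y "-1"] by simp

lemma P_zero: "app_endo P 0 = 0"
  using P_scaleR[of 0 0] by simp

lemma P_sum:
  "(\<And>i. i \<in> I \<Longrightarrow> vector_field A (X i)) \<Longrightarrow>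
    app_endo P (\<Sum>i\<in>I. X i) = (\<Sum>i\<in>I. app_endo P (X i))"
  by (induction I rule: infinite_finite_induct) (simp_all add: P_zero P_add)

lemmas P_simps = P_add P_fscale P_diff P_involution

lemma nijenhuis_vector_field [simp]:
  "vector_field A X \<Longrightarrow> vector_field A Y \<Longrightarrow> vector_field A (nijenhuis P X Y)"
  by (simp add: nijenhuis_def)

lemma tensorial_nijenhuis:
  "vector_field A Y \<Longrightarrow> tensorial (\<lambda>X. nijenhuis P X Y)"
  "vector_field A X \<Longrightarrow> tensorial (\<lambda>Y. nijenhuis P X Y)"
  by (simp_all add: tensorial_def nijenhuis_def P_simps lie_bracket_add_left lie_bracket_add_right
      lie_bracket_fscale_left lie_bracket_fscale_right fun_eq_iff algebra_simps)

end

locale affine_almost_product_manifold = affine_manifold A D + almost_product_manifold A P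
  for A :: "('a::{t2_space,second_countable_topology}, 'e::euclidean_space) chart set"
    and D :: "'a vfield \<Rightarrow> 'a vfield \<Rightarrow> 'a vfield" and P :: "'a endo_field"
begin

lemma nabla_endo_vector_field [simp]:
  "vector_field A X \<Longrightarrow> vector_field A Y \<Longrightarrow> vector_field A (nabla_endo D P X Y)"
  by (simp add: nabla_endo_def)

lemma tensorial_nabla_endo:
  "vector_field A Y \<Longrightarrow> tensorial (\<lambda>X. nabla_endo D P X Y)"
  "vector_field A X \<Longrightarrow> tensorial (\<lambda>Y. nabla_endo D P X Y)"
  by (simp_all add: tensorial_def nabla_endo_def P_simps D_simps fun_eq_iff algebra_simps)

end

subsection \<open>Metrics, orthonormal frames and traces\<close>

lemma span_range_finiteE:
  fixes e :: "'i::finite \<Rightarrow> 'v::real_vector"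
  assumes "inj e" "v \<in> span (range e)"
  obtains u where "v = (\<Sum>i\<in>UNIV. u i *\<^sub>R e i)"
proof -
  from assms(2) obtain u where "v = (\<Sum>w\<in>range e. u w *\<^sub>R w)"
    by (auto simp: span_finite)
  then have "v = (\<Sum>i\<in>UNIV. u (e i) *\<^sub>R e i)"
    using assms(1) by (simp add: sum.reindex)
  then show thesis by (rule that)
qed

lemma sum_vfield_apply: "(\<Sum>i\<in>I. X i) p = (\<Sum>i\<in>I. X i p)" for X :: "'i \<Rightarrow> 'a vfield"
  by (induction I rule: infinite_finite_induct) simp_all

locale riemannian_manifold = smooth_manifold A
  for A :: "('a::{t2_space,second_countable_topology}, 'e::euclidean_space) chart set" +
  fixes g :: "'a bilin_field"
  assumes metric: "riemannian_metric A g"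
begin

lemma g_sym: "u \<in> tangent_space A p \<Longrightarrow> v \<in> tangent_space A p \<Longrightarrow> g p u v = g p v u"
  using metric unfolding riemannian_metric_def by blast

lemma g_add_left:
  "u \<in> tangent_space A p \<Longrightarrow> v \<in> tangent_space A p \<Longrightarrow> w \<in> tangent_space A p \<Longrightarrow>
    g p (u + v) w = g p u w + g p v w"
  using metric unfolding riemannian_metric_def by blast

lemma g_scaleR_left:
  "u \<in> tangent_space A p \<Longrightarrow> v \<in> tangent_space A p \<Longrightarrow> g p (c *\<^sub>R u) v = c * g p u v"
  using metric unfolding riemannian_metric_def by blast

lemma g_add_right:
  "u \<in> tangent_space A p \<Longrightarrow> v \<in> tangent_space A p \<Longrightarrow> w \<in> tangent_space A p \<Longrightarrow>
    g p w (u + v) = g p w u + g p w v"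
  by (metis g_add_left g_sym tangent_space_add)

lemma g_scaleR_right:
  "u \<in> tangent_space A p \<Longrightarrow> v \<in> tangent_space A p \<Longrightarrow> g p v (c *\<^sub>R u) = c * g p v u"
  by (metis g_scaleR_left g_sym tangent_space_scaleR)

lemma g_diff_left:
  "u \<in> tangent_space A p \<Longrightarrow> v \<in> tangent_space A p \<Longrightarrow> w \<in> tangent_space A p \<Longrightarrow>
    g p (u - v) w = g p u w - g p v w"
  using g_add_left[of u p "- v" w] g_scaleR_left[of v p w "-1"] by simp

lemma g_sum_left:
  "(\<And>i. i \<in> I \<Longrightarrow> u i \<in> tangent_space A p) \<Longrightarrow> w \<in> tangent_space A p \<Longrightarrow>
    g p (\<Sum>i\<in>I. u i) w = (\<Sum>i\<in>I. g p (u i) w)"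
proof (induction I rule: infinite_finite_induct)
  case (insert i I)
  have "g p (u i + (\<Sum>i\<in>I. u i)) w = g p (u i) w + g p (\<Sum>i\<in>I. u i) w"
    by (rule g_add_left) (use insert.prems in \<open>auto intro: tangent_space_sum\<close>)
  then show ?case using insert by (simp only: sum.insert[OF insert.hyps] insertI1 insertI2)
qed (use g_scaleR_left[of 0 p w 0] in simp_all)

lemma smooth_fun_g [simp]:
  "vector_field A X \<Longrightarrow> vector_field A Y \<Longrightarrow> smooth_fun A (\<lambda>p. g p (X p) (Y p))"
  using metric by (simp add: riemannian_metric_def)

lemma tensorial_at_g_left:
  "tensorial T \<Longrightarrow> vector_field A Y \<Longrightarrow> tensorial_at p (\<lambda>X. g p (T X p) (Y p))"
  by (simp add: tensorial_at_def tensorial_def g_add_left g_scaleR_left)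

lemma tensorial_at_g_right:
  "tensorial T \<Longrightarrow> vector_field A Y \<Longrightarrow> tensorial_at p (\<lambda>X. g p (Y p) (T X p))"
  by (simp add: tensorial_at_def tensorial_def g_add_right g_scaleR_right)

lemma tensorial_id: "tensorial (\<lambda>X. X)"
  by (simp add: tensorial_def)

end

locale orthonormal_frame = riemannian_manifold A g
  for A :: "('a::{t2_space,second_countable_topology}, 'e::euclidean_space) chart set"
    and g :: "'a bilin_field" +
  fixes E :: "'i::finite \<Rightarrow> 'a vfield"
  assumes frame_vector_field [simp]: "vector_field A (E i)"
    and frame_basis: "tangent_basis A p (\<lambda>i. E i p)"
    and orthonormal: "g p (E i p) (E j p) = (if i = j then 1 else 0)"
begin

lemma tangent_expansion:
  assumes "v \<in> tangent_space A p"
  shows "v = (\<Sum>i\<in>UNIV. g p v (E i p) *\<^sub>R E i p)"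
proof -
  obtain u where u: "v = (\<Sum>i\<in>UNIV. u i *\<^sub>R E i p)"
    using assms frame_basis[of p] unfolding tangent_basis_def
    by (metis span_range_finiteE)
  have "g p v (E j p) = u j" for j
    unfolding u by (subst g_sum_left) (simp_all add: g_scaleR_left orthonormal if_distrib cong: if_cong)
  then show ?thesis using u by simp
qed

text \<open>An identity of fields, not only of values at a point: the coefficients are smooth on the
  whole manifold by \<open>smooth_fun_g\<close>, so they can be pulled out of any tensorial
  operator.\<close>

lemma frame_expansion:
  assumes "vector_field A V"
  shows "V = (\<Sum>i\<in>UNIV. (\<lambda>p. g p (V p) (E i p)) \<odot> E i)"
proof
  fix p
  have "V p = (\<Sum>i\<in>UNIV. g p (V p) (E i p) *\<^sub>R E i p)"
    by (rule tangent_expansion) (simp add: assms)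
  then show "V p = (\<Sum>i\<in>UNIV. (\<lambda>p. g p (V p) (E i p)) \<odot> E i) p"
    by (simp add: sum_vfield_apply)
qed

lemma parseval:
  assumes "u \<in> tangent_space A p" "v \<in> tangent_space A p"
  shows "g p u v = (\<Sum>k\<in>UNIV. g p u (E k p) * g p v (E k p))"
proof -
  have "g p u v = g p (\<Sum>i\<in>UNIV. g p u (E i p) *\<^sub>R E i p) v"
    using tangent_expansion[OF assms(1)] by simp
  also have "\<dots> = (\<Sum>k\<in>UNIV. g p u (E k p) * g p v (E k p))"
    using assms by (subst g_sum_left) (simp_all add: g_scaleR_left g_sym[of v])
  finally show ?thesis .
qed

lemma tensorial_at_expand:
  assumes "tensorial_at p T" "vector_field A V"
  shows "T V = (\<Sum>i\<in>UNIV. g p (V p) (E i p) * T (E i))"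
proof -
  have "T V = T (\<Sum>i\<in>UNIV. (\<lambda>p. g p (V p) (E i p)) \<odot> E i)"
    using frame_expansion[OF assms(2)] by simp
  also have "\<dots> = (\<Sum>i\<in>UNIV. T ((\<lambda>p. g p (V p) (E i p)) \<odot> E i))"
    by (rule tensorial_at_vsum[OF assms(1)]) (simp add: assms(2))
  also have "\<dots> = (\<Sum>i\<in>UNIV. g p (V p) (E i p) * T (E i))"
    using assms unfolding tensorial_at_def by (intro sum.cong) simp_all
  finally show ?thesis .
qed

lemma tensorial_at_zero:
  "tensorial_at p T \<Longrightarrow> (\<And>i. T (E i) = 0) \<Longrightarrow> vector_field A V \<Longrightarrow> T V = 0"
  by (simp add: tensorial_at_expand[of p T V])

lemma vector_field_eqI:
  assumes "vector_field A V" "vector_field A W" "\<And>p i. g p (V p) (E i p) = g p (W p) (E i p)"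
  shows "V = W"
  using frame_expansion[OF assms(1)] frame_expansion[OF assms(2)] assms(3) by simp

lemma tensorial_zero:
  assumes "tensorial T" "\<And>i. T (E i) = 0" "vector_field A V"
  shows "T V = 0"
proof (rule vector_field_eqI)
  show "vector_field A (T V)" using assms by (simp add: tensorial_def)
  fix p i
  have "g p ((0 :: 'a vfield) p) (E i p) = 0"
    using g_scaleR_left[of 0 p "E i p" 0] by simp
  then show "g p (T V p) (E i p) = g p ((0 :: 'a vfield) p) (E i p)"
    using tensorial_at_zero[OF tensorial_at_g_left[OF assms(1) frame_vector_field] _ assms(3)]
      assms(2) by simp
qed simp

text \<open>With \<open>a\<close> the matrix of the frame \<open>F\<close> in the orthonormal frame \<open>E\<close>, the Gram matrix of
  \<open>F\<close> is \<open>a a\<^sup>T\<close>, and \<open>a\<^sup>T (a a\<^sup>T)\<^sup>-\<^sup>1 a = 1\<close>.\<close>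

lemma trace_frame:
  fixes F :: "'i \<Rightarrow> 'a vfield"
  assumes F: "frame_at A p F"
    and T1: "\<And>Y. vector_field A Y \<Longrightarrow> tensorial_at p (\<lambda>X. T X Y)"
    and T2: "\<And>X. vector_field A X \<Longrightarrow> tensorial_at p (\<lambda>Y. T X Y)"
  shows "(\<Sum>i\<in>UNIV. \<Sum>j\<in>UNIV. ginv g F p $ i $ j * T (F i) (F j)) = (\<Sum>k\<in>UNIV. T (E k) (E k))"
proof -
  have Fv [simp]: "vector_field A (F i)" for i using F by (simp add: frame_at_def)
  define a :: "real ^ 'i ^ 'i" where "a = (\<chi> i k. g p (F i p) (E k p))"
  define H where "H = ginv g F p"
  have gram: "(\<chi> i j. g p (F i p) (F j p)) = a ** transpose a"
    by (simp add: a_def matrix_matrix_mult_def transpose_def vec_eq_iff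
        parseval[of "F _ p" p "F _ p"])
  \<comment> \<open>The coefficients of \<open>E\<close> in terms of \<open>F\<close> form a left
    inverse of \<open>a\<close>, which makes the square matrix \<open>a\<close>, and then the Gram
    matrix, invertible.\<close>
  have "\<exists>u. E k p = (\<Sum>i\<in>UNIV. u i *\<^sub>R F i p)" for k
    using F vfield_tangent[OF frame_vector_field, of k p] unfolding frame_at_def tangent_basis_def
    by (metis span_range_finiteE)
  then obtain b where b: "\<And>k. E k p = (\<Sum>i\<in>UNIV. b k i *\<^sub>R F i p)" by metis
  have "(\<Sum>i\<in>UNIV. b k i * g p (F i p) (E l p)) = (if k = l then 1 else 0)" for k l
  proof -
    have "g p (E k p) (E l p) = (\<Sum>i\<in>UNIV. b k i * g p (F i p) (E l p))"
      unfolding b[of k] by (subst g_sum_left) (simp_all add: g_scaleR_left)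
    then show ?thesis by (simp add: orthonormal)
  qed
  then have "(\<chi> k i. b k i) ** a = mat 1"
    by (simp add: a_def matrix_matrix_mult_def mat_def vec_eq_iff)
  then have "invertible a" by (meson invertible_left_inverse)
  then have "invertible (a ** transpose a)"
    by (intro invertible_mult transpose_invertible)
  \<comment> \<open>\<open>matrix_inv\<close> is a choice operator; its defining equations become
    available only once an inverse is known to exist.\<close>
  then have "(a ** transpose a) ** H = mat 1"
    unfolding H_def ginv_def gram matrix_inv_def invertible_def
    by (rule someI_ex[THEN conjunct1])
  \<comment> \<open>A right inverse of a square matrix is also a left inverse, which moves
    \<open>a\<close> to the other end of the product.\<close>
  then have "a ** (transpose a ** H) = mat 1" by (simp add: matrix_mul_assoc)
  then have "(transpose a ** H) ** a = mat 1" by (simp add: matrix_left_right_inverse)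
  then have dual: "(\<Sum>j\<in>UNIV. (\<Sum>i\<in>UNIV. a $ i $ k * H $ i $ j) * a $ j $ l) = (if k = l then 1 else 0)"
    for k l
    by (simp add: matrix_matrix_mult_def mat_def vec_eq_iff transpose_def)
  have T: "T (F i) (F j) = (\<Sum>k\<in>UNIV. \<Sum>l\<in>UNIV. a $ i $ k * a $ j $ l * T (E k) (E l))" for i j
    using tensorial_at_expand[OF T1, of "F j" "F i"] tensorial_at_expand[OF T2, of _ "F j"]
    by (simp add: a_def sum_distrib_left mult.assoc)
  have "(\<Sum>i\<in>UNIV. \<Sum>j\<in>UNIV. H $ i $ j * T (F i) (F j)) =
      (\<Sum>i\<in>UNIV. \<Sum>j\<in>UNIV. \<Sum>k\<in>UNIV. \<Sum>l\<in>UNIV. a $ i $ k * H $ i $ j * a $ j $ l * T (E k) (E l))"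
    by (simp add: T sum_distrib_left mult_ac)
  also have "\<dots> =
      (\<Sum>k\<in>UNIV. \<Sum>l\<in>UNIV. \<Sum>j\<in>UNIV. \<Sum>i\<in>UNIV. a $ i $ k * H $ i $ j * a $ j $ l * T (E k) (E l))"
    (is "_ = ?R")
  \<comment> \<open>Five adjacent exchanges bring the order i, j, k, l to k, l, j, i, so that the
    two inner sums are the left-hand side of \<open>dual\<close>.\<close>
  proof -
    let ?t = "\<lambda>i j k l. a $ i $ k * H $ i $ j * a $ j $ l * T (E k) (E l)"
    have "(\<Sum>i\<in>UNIV. \<Sum>j\<in>UNIV. \<Sum>k\<in>UNIV. \<Sum>l\<in>UNIV. ?t i j k l) =
        (\<Sum>j\<in>UNIV. \<Sum>i\<in>UNIV. \<Sum>k\<in>UNIV. \<Sum>l\<in>UNIV. ?t i j k l)" by (rule sum.swap)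
    also have "\<dots> = (\<Sum>j\<in>UNIV. \<Sum>k\<in>UNIV. \<Sum>i\<in>UNIV. \<Sum>l\<in>UNIV. ?t i j k l)"
      by (rule sum.cong[OF refl], rule sum.swap)
    also have "\<dots> = (\<Sum>k\<in>UNIV. \<Sum>j\<in>UNIV. \<Sum>i\<in>UNIV. \<Sum>l\<in>UNIV. ?t i j k l)"
      by (rule sum.swap)
    also have "\<dots> = (\<Sum>k\<in>UNIV. \<Sum>j\<in>UNIV. \<Sum>l\<in>UNIV. \<Sum>i\<in>UNIV. ?t i j k l)"
      by (rule sum.cong[OF refl], rule sum.cong[OF refl], rule sum.swap)
    also have "\<dots> = ?R"
      by (rule sum.cong[OF refl], rule sum.swap)
    finally show ?thesis .
  qed
  also have "\<dots> = (\<Sum>k\<in>UNIV. \<Sum>l\<in>UNIV.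
      (\<Sum>j\<in>UNIV. (\<Sum>i\<in>UNIV. a $ i $ k * H $ i $ j) * a $ j $ l) * T (E k) (E l))"
    by (simp add: sum_distrib_right)
  also have "\<dots> = (\<Sum>k\<in>UNIV. T (E k) (E k))"
    by (simp add: dual if_distrib[of "\<lambda>x. x * _"] cong: if_cong)
  finally show ?thesis by (simp add: H_def)
qed

text \<open>The index pairs are contracted separately: \<open>trace_frame\<close> for (k, s) with
  \<open>F i\<close>, \<open>F j\<close> held fixed, then again for (i, j) applied to the sum over k
  that results.\<close>

lemma norm2_trace:
  fixes F :: "'i \<Rightarrow> 'a vfield"
  assumes F: "frame_at A p F"
    and T1: "\<And>Y. vector_field A Y \<Longrightarrow> tensorial (\<lambda>X. T X Y)"
    and T2: "\<And>X. vector_field A X \<Longrightarrow> tensorial (\<lambda>Y. T X Y)"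
  shows "(\<Sum>i\<in>UNIV. \<Sum>j\<in>UNIV. \<Sum>k\<in>UNIV. \<Sum>s\<in>UNIV.
      ginv g F p $ i $ j * ginv g F p $ k $ s * g p (T (F i) (F k) p) (T (F j) (F s) p)) =
    (\<Sum>i\<in>UNIV. \<Sum>k\<in>UNIV. g p (T (E i) (E k) p) (T (E i) (E k) p))"
proof -
  have Fv [simp]: "vector_field A (F i)" for i using F by (simp add: frame_at_def)
  have Tv [simp]: "vector_field A (T X Y)" if "vector_field A X" "vector_field A Y" for X Y
    using T1[OF that(2)] that(1) by (simp add: tensorial_def)
  have inner: "(\<Sum>k\<in>UNIV. \<Sum>s\<in>UNIV. ginv g F p $ k $ s * g p (T X (F k) p) (T Y (F s) p)) =
      (\<Sum>k\<in>UNIV. g p (T X (E k) p) (T Y (E k) p))"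
    if "vector_field A X" "vector_field A Y" for X Y
    by (rule trace_frame[OF F, where T = "\<lambda>V W. g p (T X V p) (T Y W p)"])
      (intro tensorial_at_g_left[OF T2] tensorial_at_g_right[OF T2] Tv that; assumption)+
  have "(\<Sum>i\<in>UNIV. \<Sum>j\<in>UNIV. \<Sum>k\<in>UNIV. \<Sum>s\<in>UNIV.
      ginv g F p $ i $ j * ginv g F p $ k $ s * g p (T (F i) (F k) p) (T (F j) (F s) p)) =
    (\<Sum>i\<in>UNIV. \<Sum>j\<in>UNIV. ginv g F p $ i $ j * (\<Sum>k\<in>UNIV. \<Sum>s\<in>UNIV.
      ginv g F p $ k $ s * g p (T (F i) (F k) p) (T (F j) (F s) p)))"
    by (simp add: sum_distrib_left mult.assoc)
  also have "\<dots> = (\<Sum>i\<in>UNIV. \<Sum>j\<in>UNIV. ginv g F p $ i $ j *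
      (\<Sum>k\<in>UNIV. g p (T (F i) (E k) p) (T (F j) (E k) p)))"
    by (simp add: inner)
  also have "\<dots> = (\<Sum>i\<in>UNIV. \<Sum>k\<in>UNIV. g p (T (E i) (E k) p) (T (E i) (E k) p))"
    by (rule trace_frame[OF F, where T = "\<lambda>X Y. \<Sum>k\<in>UNIV. g p (T X (E k) p) (T Y (E k) p)"])
      (intro tensorial_at_sum tensorial_at_g_left[OF T1] tensorial_at_g_right[OF T1] Tv
        frame_vector_field; assumption)+
  finally show ?thesis .
qed

end

subsection \<open>Orthonormal frames with skew-symmetric structure constants\<close>

text \<open>No group occurs here: left invariance is replaced by the constancy of the Gram matrix
  and of the structure constants. The two skewness assumptions together give total skewness of
  \<open>c\<close>.\<close>

locale skew_frame = affine_manifold A D + orthonormal_frame A g E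
  for A :: "('a::{t2_space,second_countable_topology}, 'e::euclidean_space) chart set"
    and D :: "'a vfield \<Rightarrow> 'a vfield \<Rightarrow> 'a vfield"
    and g :: "'a bilin_field"
    and E :: "'i::finite \<Rightarrow> 'a vfield" +
  fixes c :: "'i \<Rightarrow> 'i \<Rightarrow> 'i \<Rightarrow> real"
  assumes levi_civita: "levi_civita A g D"
    and bracket_frame: "lie_bracket (E i) (E j) = (\<Sum>k\<in>UNIV. c i j k *\<^sub>R E k)"
    and skew_12: "c j i k = - c i j k"
    and skew_23: "c i k j = - c i j k"
begin

text \<open>The combinations with constant coefficients play the role of the Lie algebra; in the
  group case every left-invariant field has this form, by \<open>left_invariant_lin\<close>.\<close>

definition lin :: "('i \<Rightarrow> real) \<Rightarrow> 'a vfield" where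
  "lin a = (\<Sum>k\<in>UNIV. a k *\<^sub>R E k)"

lemma lin_vector_field [simp]: "vector_field A (lin a)"
  by (simp add: lin_def)

lemma lin_add: "lin a + lin b = lin (\<lambda>k. a k + b k)"
  by (simp add: lin_def sum.distrib scaleR_add_left)

lemma lin_scaleR: "r *\<^sub>R lin a = lin (\<lambda>k. r * a k)"
  by (simp add: lin_def scaleR_sum_right)

lemma lin_diff: "lin a - lin b = lin (\<lambda>k. a k - b k)"
  by (simp add: lin_def sum_subtractf scaleR_diff_left)

lemma lin_sum: "(\<Sum>m\<in>I. lin (t m)) = lin (\<lambda>k. \<Sum>m\<in>I. t m k)"
  unfolding lin_def by (subst sum.swap) (simp add: scaleR_sum_left)

lemma g_lin_frame: "g p (lin a p) (E k p) = a k"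
  unfolding lin_def
  by (subst sum_vfield_apply, subst g_sum_left)
    (simp_all add: g_scaleR_left orthonormal if_distrib cong: if_cong)

lemma g_lin_lin: "g p (lin a p) (lin b p) = (\<Sum>k\<in>UNIV. a k * b k)"
  by (subst parseval) (simp_all add: g_lin_frame)

lemma bracket_lin: "lie_bracket (E i) (E j) = lin (c i j)"
  by (simp add: bracket_frame lin_def)

text \<open>Koszul's formula: the derivatives of the constants \<open>g(E i, E j)\<close> vanish, and skew-symmetry
  makes the three bracket terms equal up to sign.\<close>

lemma D_frame: "D (E i) (E j) = lin (\<lambda>k. c i j k / 2)"
proof (rule vector_field_eqI)
  fix p k
  define G where "G = (\<lambda>i j k. g p (D (E i) (E j) p) (E k p))"
  have compat: "G i j k + G i k j = 0" for i j k
  proof -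
    have "E i p (\<lambda>q. g q (E j q) (E k q)) = G i j k + g p (E j p) (D (E i) (E k) p)"
      using levi_civita unfolding levi_civita_def G_def by simp
    then show ?thesis
      by (simp add: orthonormal vfield_const G_def g_sym[of "E j p"])
  qed
  have torsion: "G i j k - G j i k = c i j k" for i j k
  proof -
    have "D (E i) (E j) - D (E j) (E i) = lin (c i j)"
      using levi_civita unfolding levi_civita_def by (simp add: bracket_lin)
    then have "g p ((D (E i) (E j) - D (E j) (E i)) p) (E k p) = c i j k"
      by (simp only: g_lin_frame)
    then show ?thesis by (simp add: G_def g_diff_left)
  qed
  \<comment> \<open>\<open>compat\<close> leaves three unknowns a = \<open>G i j k\<close>, b =
    \<open>G j k i\<close>, d = \<open>G k i j\<close>. As \<open>c\<close> is cyclically invariant,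
    \<open>torsion\<close> reads a + b = b + d = d + a = \<open>c i j k\<close>, whence a is half of
    it.\<close>
  have "2 * G i j k = c i j k"
    using compat[of i j k] compat[of j k i] compat[of k i j] torsion[of i j k] torsion[of j k i]
      torsion[of k i j] skew_12[of j k i] skew_23[of j i k] skew_12[of i j k] skew_23[of k i j]
      skew_12[of k i j] skew_23[of i j k] skew_12[of j i k] skew_12[of k j i] skew_23[of k j i]
      skew_12[of i k j]
    by linarith
  then show "g p (D (E i) (E j) p) (E k p) = g p (lin (\<lambda>k. c i j k / 2) p) (E k p)"
    by (simp add: G_def g_lin_frame)
qed simp_all

lemma D_frame_lin: "D (E i) (lin a) = lin (\<lambda>k. \<Sum>m\<in>UNIV. a m * c i m k / 2)"
proof -
  have "D (E i) (lin a) = (\<Sum>m\<in>UNIV. a m *\<^sub>R D (E i) (E m))"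
    unfolding lin_def by (subst D_sum_right) (simp_all add: D_scaleR_right)
  then show ?thesis by (simp add: D_frame lin_scaleR lin_sum)
qed

lemma D_lin_frame: "D (lin a) (E i) = lin (\<lambda>k. \<Sum>m\<in>UNIV. a m * c m i k / 2)"
proof -
  have "D (lin a) (E i) = (\<Sum>m\<in>UNIV. a m *\<^sub>R D (E m) (E i))"
    unfolding lin_def by (subst D_sum_left) (simp_all add: D_scaleR_left)
  then show ?thesis by (simp add: D_frame lin_scaleR lin_sum)
qed

text \<open>The expansion of \<open>curv\<close> before any use of the Jacobi identity. Each
  application of \<open>D\<close> carries a factor 1/2 and the bracket none, hence the 2 in the last
  term under the common denominator 4.\<close>

definition curv_coeff :: "'i \<Rightarrow> 'i \<Rightarrow> 'i \<Rightarrow> 'i \<Rightarrow> real" where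
  "curv_coeff i j k l =
     (\<Sum>m\<in>UNIV. c j k m * c i m l - c i k m * c j m l - 2 * c i j m * c m k l) / 4"

lemma curv_frame: "curv D (E i) (E j) (E k) = lin (curv_coeff i j k)"
  by (simp add: curv_def D_frame D_frame_lin bracket_lin D_lin_frame lin_diff)
    (rule arg_cong[where f = lin], simp add: curv_coeff_def sum_subtractf sum_divide_distrib diff_divide_distrib fun_eq_iff
      mult_ac)

lemma riem_frame: "riem g D (E i) (E j) (E k) (E l) p = curv_coeff i j k l"
  by (simp add: riem_def curv_frame g_lin_frame)

lemma tensorial_at_riem:
  "vector_field A Y \<Longrightarrow> vector_field A Z \<Longrightarrow> vector_field A W \<Longrightarrow> tensorial_at p (\<lambda>X. riem g D X Y Z W p)"
  "vector_field A X \<Longrightarrow> vector_field A Z \<Longrightarrow> vector_field A W \<Longrightarrow> tensorial_at p (\<lambda>Y. riem g D X Y Z W p)"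
  "vector_field A X \<Longrightarrow> vector_field A Y \<Longrightarrow> vector_field A W \<Longrightarrow> tensorial_at p (\<lambda>Z. riem g D X Y Z W p)"
  "vector_field A X \<Longrightarrow> vector_field A Y \<Longrightarrow> vector_field A Z \<Longrightarrow> tensorial_at p (\<lambda>W. riem g D X Y Z W p)"
  unfolding riem_def
  by (intro tensorial_at_g_left[OF tensorial_curv(1)] tensorial_at_g_left[OF tensorial_curv(2)]
      tensorial_at_g_left[OF tensorial_curv(3)] tensorial_at_g_right[OF tensorial_id]
      curv_vector_field; assumption)+

section \<open>Ricci tensor and scalar curvature, traced over an arbitrary basis at a point\<close>

definition ricci_coeff :: "'i \<Rightarrow> 'i \<Rightarrow> real" where
  "ricci_coeff i j = (\<Sum>k\<in>UNIV. curv_coeff k i j k)"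

definition scalar_coeff :: real where
  "scalar_coeff = (\<Sum>i\<in>UNIV. ricci_coeff i i)"

context
  fixes F :: "'i \<Rightarrow> 'a vfield" and p :: 'a
  assumes F: "frame_at A p F"
begin

lemma ricci_trace:
  assumes "vector_field A Y" "vector_field A Z"
  shows "ricci g D F Y Z p = (\<Sum>k\<in>UNIV. riem g D (E k) Y Z (E k) p)"
  unfolding ricci_def by (rule trace_frame[OF F]) (simp_all add: tensorial_at_riem assms)

lemma frame_at_vector_field: "vector_field A (F i)"
  using F by (simp add: frame_at_def)

lemma ricci_frame: "ricci g D F (E i) (E j) p = ricci_coeff i j"
  by (simp add: ricci_trace riem_frame ricci_coeff_def)

lemma tensorial_at_ricci:
  "vector_field A Z \<Longrightarrow> tensorial_at p (\<lambda>Y. ricci g D F Y Z p)"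
  "vector_field A Y \<Longrightarrow> tensorial_at p (\<lambda>Z. ricci g D F Y Z p)"
  unfolding ricci_def
  by (intro tensorial_at_sum tensorial_at_cmult tensorial_at_riem frame_at_vector_field; assumption)+

lemma scalar_curvature_frame: "scalar_curvature g D F p = scalar_coeff"
proof -
  have "scalar_curvature g D F p = (\<Sum>i\<in>UNIV. ricci g D F (E i) (E i) p)"
    unfolding scalar_curvature_def by (rule trace_frame[OF F]) (simp_all add: tensorial_at_ricci)
  then show ?thesis by (simp add: ricci_frame scalar_coeff_def)
qed

end

section \<open>Fields with constant coefficients: local symmetry and the Killing property\<close>

lemma D_lin_lin_coeff:
  "D (lin x) (lin y) = lin (\<lambda>k. \<Sum>i\<in>UNIV. \<Sum>j\<in>UNIV. x i * y j * c i j k / 2)"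
proof -
  have "D (lin x) (lin y) = (\<Sum>i\<in>UNIV. x i *\<^sub>R D (E i) (lin y))"
    by (subst lin_def, subst D_sum_left) (simp_all add: D_scaleR_left)
  then show ?thesis by (simp add: D_frame_lin lin_scaleR lin_sum sum_distrib_left mult_ac)
qed

text \<open>The connection has no torsion, so the bracket is the antisymmetrisation of
  \<open>D_lin_lin_coeff\<close>; skewness of \<open>c\<close> makes its two halves equal.\<close>

lemma lie_bracket_lin_lin:
  "lie_bracket (lin x) (lin y) = lin (\<lambda>k. \<Sum>i\<in>UNIV. \<Sum>j\<in>UNIV. x i * y j * c i j k)"
proof -
  have swap: "(\<Sum>i\<in>UNIV. \<Sum>j\<in>UNIV. y i * x j * c i j k / 2) =
      - (\<Sum>i\<in>UNIV. \<Sum>j\<in>UNIV. x i * y j * c i j k / 2)" for k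
  proof -
    have "(\<Sum>i\<in>UNIV. \<Sum>j\<in>UNIV. y i * x j * c i j k / 2) =
        (\<Sum>i\<in>UNIV. \<Sum>j\<in>UNIV. y j * x i * c j i k / 2)"
      by (rule sum.swap)
    also have "\<dots> = (\<Sum>i\<in>UNIV. \<Sum>j\<in>UNIV. - (x i * y j * c i j k / 2))"
      by (intro sum.cong refl) (subst skew_12, simp)
    finally show ?thesis by (simp add: sum_negf)
  qed
  have "lie_bracket (lin x) (lin y) = D (lin x) (lin y) - D (lin y) (lin x)"
    using levi_civita by (simp add: levi_civita_def)
  also have "\<dots> = lin (\<lambda>k. (\<Sum>i\<in>UNIV. \<Sum>j\<in>UNIV. x i * y j * c i j k / 2)
      + (\<Sum>i\<in>UNIV. \<Sum>j\<in>UNIV. x i * y j * c i j k / 2))"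
    unfolding D_lin_lin_coeff lin_diff swap by simp
  also have "\<dots> = lin (\<lambda>k. \<Sum>i\<in>UNIV. \<Sum>j\<in>UNIV. x i * y j * c i j k)"
    by (simp add: mult.assoc flip: sum.distrib)
  finally show ?thesis .
qed

lemma D_lin_lin: "D (lin x) (lin y) = (1 / 2) *\<^sub>R lie_bracket (lin x) (lin y)"
  by (simp add: D_lin_lin_coeff lie_bracket_lin_lin lin_scaleR sum_distrib_left)

text \<open>On the constant combinations of the frame \<open>D X Y\<close> is half the bracket, so the Jacobi identity
  turns the curvature into \<open>-[[X, Y], Z] / 4\<close>, which every \<open>[V, _]\<close> differentiates by the Leibniz
  rule.\<close>

lemma locally_symmetric: "locally_symmetric A D"
proof -
  have D: "D X Y = (1 / 2) *\<^sub>R lie_bracket X Y" if "X \<in> range lin" "Y \<in> range lin" for X Y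
    using that D_lin_lin by auto
  have closed: "X \<in> range lin \<Longrightarrow> Y \<in> range lin \<Longrightarrow> lie_bracket X Y \<in> range lin"
    "X \<in> range lin \<Longrightarrow> r *\<^sub>R X \<in> range lin" for r X Y
    using lie_bracket_lin_lin lin_scaleR by auto
  have vf: "vector_field A X" if "X \<in> range lin" for X using that by auto
  \<comment> \<open>By Jacobi, [X, [Y, Z]] - [Y, [X, Z]] = [[X, Y], Z], so the curvature has the
    factor 1/4 - 1/2.\<close>
  define q :: real where "q = - 1 / 4"
  have R: "curv D X Y Z = q *\<^sub>R lie_bracket (lie_bracket X Y) Z"
    if "X \<in> range lin" "Y \<in> range lin" "Z \<in> range lin" for X Y Z
    using that
    by (simp add: curv_def D closed vf lie_bracket_scaleR lie_bracket_jacobi[of X Y Z]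
        fun_eq_iff q_def field_simps)
  have frame: "nabla_curv D (E v) (E i) (E j) (E k) = 0" for v i j k
  proof -
    have E: "E i \<in> range lin" for i
    proof -
      have "E i = lin (\<lambda>k. if k = i then 1 else 0)"
        by (simp add: lin_def if_distrib[of "\<lambda>x. x *\<^sub>R _"] cong: if_cong)
      then show ?thesis by blast
    qed
    have "lie_bracket (E v) (lie_bracket (lie_bracket (E i) (E j)) (E k)) =
        lie_bracket (lie_bracket (lie_bracket (E v) (E i)) (E j)) (E k)
        + lie_bracket (lie_bracket (E i) (lie_bracket (E v) (E j))) (E k)
        + lie_bracket (lie_bracket (E i) (E j)) (lie_bracket (E v) (E k))"
      by (simp add: lie_bracket_jacobi[of "E v" "lie_bracket (E i) (E j)" "E k"]
          lie_bracket_jacobi[of "E v" "E i" "E j"] lie_bracket_add_left)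
    then show ?thesis
      by (simp add: nabla_curv_def D R E closed vf lie_bracket_scaleR fun_eq_iff algebra_simps)
  qed
  \<comment> \<open>The arguments pass from frame fields to arbitrary fields one slot at a
    time.\<close>
  have 1: "nabla_curv D V (E i) (E j) (E k) = 0" if "vector_field A V" for V i j k
    by (rule tensorial_zero[where T = "\<lambda>V. nabla_curv D V _ _ _"])
      (simp_all add: tensorial_nabla_curv that frame)
  have 2: "nabla_curv D V X (E j) (E k) = 0" if "vector_field A V" "vector_field A X" for V X j k
    by (rule tensorial_zero[where T = "\<lambda>X. nabla_curv D V X _ _"])
      (simp_all add: tensorial_nabla_curv that 1)
  have 3: "nabla_curv D V X Y (E k) = 0"
    if "vector_field A V" "vector_field A X" "vector_field A Y" for V X Y k
    by (rule tensorial_zero[where T = "\<lambda>Y. nabla_curv D V X Y _"])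
      (simp_all add: tensorial_nabla_curv that 2)
  have "nabla_curv D V X Y Z = 0"
    if "vector_field A V" "vector_field A X" "vector_field A Y" "vector_field A Z" for V X Y Z
    by (rule tensorial_zero[where T = "\<lambda>Z. nabla_curv D V X Y Z"])
      (simp_all add: tensorial_nabla_curv that 3)
  then show ?thesis by (simp add: locally_symmetric_def)
qed

lemma g_bracket_lin:
  "g p (lie_bracket (lin x) (lin y) p) (lin z p) =
    (\<Sum>i\<in>UNIV. \<Sum>j\<in>UNIV. \<Sum>k\<in>UNIV. x i * y j * z k * c i j k)"
proof -
  have "g p (lie_bracket (lin x) (lin y) p) (lin z p) =
      (\<Sum>k\<in>UNIV. \<Sum>i\<in>UNIV. \<Sum>j\<in>UNIV. x i * y j * z k * c i j k)"
    by (simp add: lie_bracket_lin_lin g_lin_lin sum_distrib_right sum_distrib_left mult_ac)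
  also have "\<dots> = (\<Sum>i\<in>UNIV. \<Sum>k\<in>UNIV. \<Sum>j\<in>UNIV. x i * y j * z k * c i j k)"
    by (rule sum.swap)
  also have "\<dots> = (\<Sum>i\<in>UNIV. \<Sum>j\<in>UNIV. \<Sum>k\<in>UNIV. x i * y j * z k * c i j k)"
    by (rule sum.cong[OF refl], rule sum.swap)
  finally show ?thesis .
qed

text \<open>Translation by \<open>q\<close> carries the values at \<open>e\<close> to those at
  \<open>q\<close> and preserves \<open>g\<close>, so the coefficients g(X, E i) are
  constant.\<close>

lemma left_invariant_lin:
  assumes grp: "group mul e iv" and met: "left_invariant_metric A mul g"
    and E: "\<And>i. left_invariant A mul (E i)" and X: "left_invariant A mul X"
  shows "\<exists>x. X = lin x"
proof -
  interpret group mul e iv by (rule grp)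
  have Xv: "vector_field A X" using X by (simp add: left_invariant_def)
  have const: "g q (X q) (E i q) = g e (X e) (E i e)" for q i
  proof -
    have "g (mul q e) (pushforward A (mul q) (X e)) (pushforward A (mul q) (E i e)) =
        g e (X e) (E i e)"
      using met vfield_tangent[OF Xv] vfield_tangent[OF frame_vector_field]
      unfolding left_invariant_metric_def by blast
    moreover have "X (mul q e) = pushforward A (mul q) (X e)"
      "E i (mul q e) = pushforward A (mul q) (E i e)"
      using X E[of i] unfolding left_invariant_def by blast+
    ultimately show ?thesis by simp
  qed
  have "X = lin (\<lambda>i. g e (X e) (E i e))"
  proof (rule vector_field_eqI)
    show "g p (X p) (E i p) = g p (lin (\<lambda>i. g e (X e) (E i e)) p) (E i p)" for p i
      unfolding g_lin_frame by (rule const)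
  qed (simp_all add: Xv)
  then show ?thesis by blast
qed

text \<open>On constant combinations the two terms are trilinear in the coefficients; after
  exchanging j and k in the second they cancel by \<open>skew_23\<close>.\<close>

lemma killing_metricI:
  assumes "group mul e iv" "left_invariant_metric A mul g" "\<And>i. left_invariant A mul (E i)"
  shows "killing_metric A mul g"
  unfolding killing_metric_def
proof (intro allI impI)
  fix X Y Z p
  assume "left_invariant A mul X" "left_invariant A mul Y" "left_invariant A mul Z"
  then obtain x y z where [simp]: "X = lin x" "Y = lin y" "Z = lin z"
    using left_invariant_lin[OF assms] by metis
  have "(\<Sum>i\<in>UNIV. \<Sum>j\<in>UNIV. \<Sum>k\<in>UNIV. x i * z j * y k * c i j k) =
      (\<Sum>i\<in>UNIV. \<Sum>j\<in>UNIV. \<Sum>k\<in>UNIV. x i * z k * y j * c i k j)"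
    by (rule sum.cong[OF refl], rule sum.swap)
  also have "\<dots> = - (\<Sum>i\<in>UNIV. \<Sum>j\<in>UNIV. \<Sum>k\<in>UNIV. x i * y j * z k * c i j k)"
  proof -
    have "x i * z k * y j * c i k j = - (x i * y j * z k * c i j k)" for i j k
      by (subst skew_23) simp
    then show ?thesis by (simp add: sum_negf)
  qed
  finally show "g p (lie_bracket X Y p) (Z p) + g p (lie_bracket X Z p) (Y p) = 0"
    by (simp add: g_bracket_lin)
qed

end

locale skew_frame_4 = skew_frame A D g E c
  for A :: "('a::{t2_space,second_countable_topology}, 'e::euclidean_space) chart set"
    and D :: "'a vfield \<Rightarrow> 'a vfield \<Rightarrow> 'a vfield"
    and g :: "'a bilin_field"
    and E :: "4 \<Rightarrow> 'a vfield"
    and c :: "4 \<Rightarrow> 4 \<Rightarrow> 4 \<Rightarrow> real"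
begin

text \<open>Kronecker deltas are written with \<open>of_bool\<close> and can be treated as atoms, so
  that identities between these tensors become polynomial and need no case distinction on the
  indices.\<close>

definition pi1_coeff :: "4 \<Rightarrow> 4 \<Rightarrow> 4 \<Rightarrow> 4 \<Rightarrow> real" where
  "pi1_coeff i j k l = of_bool (j = k) * of_bool (i = l) - of_bool (i = k) * of_bool (j = l)"

definition psi1_coeff :: "4 \<Rightarrow> 4 \<Rightarrow> 4 \<Rightarrow> 4 \<Rightarrow> real" where
  "psi1_coeff i j k l =
     of_bool (j = k) * ricci_coeff i l - of_bool (i = k) * ricci_coeff j l
     + ricci_coeff j k * of_bool (i = l) - ricci_coeff i k * of_bool (j = l)"

text \<open>The tracing basis \<open>F\<close> stays fixed while the four arguments pass one by one
  from \<open>E\<close> to arbitrary fields; every summand is tensorial in each of them.\<close>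

lemma weyl_zeroI:
  assumes "\<And>i j k l. curv_coeff i j k l =
    1 / 2 * (psi1_coeff i j k l - scalar_coeff / 3 * pi1_coeff i j k l)"
  shows "weyl_zero A g D"
  unfolding weyl_zero_def
proof (intro allI impI)
  fix p X Y Z W and F :: "4 \<Rightarrow> 'a vfield"
  assume F: "frame_at A p F"
    and [simp]: "vector_field A X" "vector_field A Y" "vector_field A Z" "vector_field A W"
  note tens = tensorial_at_diff tensorial_at_add tensorial_at_cmult tensorial_at_cmult_right
    tensorial_at_riem tensorial_at_ricci[OF F]
    tensorial_at_g_left[OF tensorial_id] tensorial_at_g_right[OF tensorial_id]
  have 0: "weyl4 g D F (E i) (E j) (E k) (E l) p = 0" for i j k l
    by (simp add: weyl4_def psi1_ricci_def pi1_def riem_frame ricci_frame[OF F]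
        scalar_curvature_frame[OF F] orthonormal)
      (simp add: assms psi1_coeff_def pi1_coeff_def of_bool_def)
  have 1: "weyl4 g D F X (E j) (E k) (E l) p = 0" for j k l
    by (rule tensorial_at_zero[where p = p and T = "\<lambda>X. weyl4 g D F X (E j) (E k) (E l) p", OF _ 0])
      (unfold weyl4_def psi1_ricci_def pi1_def, (intro tens; simp)+, simp)
  have 2: "weyl4 g D F X Y (E k) (E l) p = 0" for k l
    by (rule tensorial_at_zero[where p = p and T = "\<lambda>Y. weyl4 g D F X Y (E k) (E l) p", OF _ 1])
      (unfold weyl4_def psi1_ricci_def pi1_def, (intro tens; simp)+, simp)
  have 3: "weyl4 g D F X Y Z (E l) p = 0" for l
    by (rule tensorial_at_zero[where p = p and T = "\<lambda>Z. weyl4 g D F X Y Z (E l) p", OF _ 2])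
      (unfold weyl4_def psi1_ricci_def pi1_def, (intro tens; simp)+, simp)
  show "weyl4 g D F X Y Z W p = 0"
    by (rule tensorial_at_zero[where p = p and T = "\<lambda>W. weyl4 g D F X Y Z W p", OF _ 3])
      (unfold weyl4_def psi1_ricci_def pi1_def, (intro tens; simp)+, simp)
qed

end

section \<open>The tensors F and N when P permutes the frame\<close>

locale skew_product_frame = skew_frame A D g E c + affine_almost_product_manifold A D P
  for A :: "('a::{t2_space,second_countable_topology}, 'e::euclidean_space) chart set"
    and D :: "'a vfield \<Rightarrow> 'a vfield \<Rightarrow> 'a vfield"
    and g :: "'a bilin_field"
    and E :: "'i::finite \<Rightarrow> 'a vfield"
    and c :: "'i \<Rightarrow> 'i \<Rightarrow> 'i \<Rightarrow> real"
    and P :: "'a endo_field" +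
  fixes \<sigma> :: "'i \<Rightarrow> 'i"
  assumes P_frame: "app_endo P (E i) = E (\<sigma> i)"
    and \<sigma>_involution: "\<sigma> (\<sigma> i) = i"
begin

lemma P_lin: "app_endo P (lin a) = lin (\<lambda>k. a (\<sigma> k))"
proof -
  have "app_endo P (lin a) = (\<Sum>k\<in>UNIV. a k *\<^sub>R E (\<sigma> k))"
    unfolding lin_def by (subst P_sum) (simp_all add: P_scaleR P_frame)
  also have "\<dots> = lin (\<lambda>k. a (\<sigma> k))"
    unfolding lin_def by (rule sum.reindex_bij_witness[of _ \<sigma> \<sigma>]) (simp_all add: \<sigma>_involution)
  finally show ?thesis .
qed

definition F_coeff :: "'i \<Rightarrow> 'i \<Rightarrow> 'i \<Rightarrow> real" where
  "F_coeff i j k = (c i (\<sigma> j) k - c i j (\<sigma> k)) / 2"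

definition nijenhuis_coeff :: "'i \<Rightarrow> 'i \<Rightarrow> 'i \<Rightarrow> real" where
  "nijenhuis_coeff i j k = c i j k + c (\<sigma> i) (\<sigma> j) k - c (\<sigma> i) j (\<sigma> k) - c i (\<sigma> j) (\<sigma> k)"

lemma nabla_endo_frame: "nabla_endo D P (E i) (E j) = lin (F_coeff i j)"
  by (simp add: nabla_endo_def P_frame D_frame P_lin lin_diff F_coeff_def[abs_def]
      diff_divide_distrib)

lemma nijenhuis_frame: "nijenhuis P (E i) (E j) = lin (nijenhuis_coeff i j)"
  by (simp add: nijenhuis_def P_frame bracket_lin P_lin lin_add lin_diff
      nijenhuis_coeff_def[abs_def])

lemma F_tensor_frame: "F_tensor g D P (E i) (E j) (E k) p = F_coeff i j k"
  by (simp add: F_tensor_def nabla_endo_frame g_lin_frame)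

lemma tensorial_at_F_tensor:
  "vector_field A Y \<Longrightarrow> vector_field A Z \<Longrightarrow> tensorial_at p (\<lambda>X. F_tensor g D P X Y Z p)"
  "vector_field A X \<Longrightarrow> vector_field A Z \<Longrightarrow> tensorial_at p (\<lambda>Y. F_tensor g D P X Y Z p)"
  "vector_field A X \<Longrightarrow> vector_field A Y \<Longrightarrow> tensorial_at p (\<lambda>Z. F_tensor g D P X Y Z p)"
  unfolding F_tensor_def
  by (intro tensorial_at_g_left[OF tensorial_nabla_endo(1)]
      tensorial_at_g_left[OF tensorial_nabla_endo(2)] tensorial_at_g_right[OF tensorial_id]
      nabla_endo_vector_field; assumption)+

lemma W3_manifoldI:
  assumes "\<And>i j k. F_coeff i j k + F_coeff j k i + F_coeff k i j = 0"
  shows "W3_manifold A g D P"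
  unfolding W3_manifold_def
proof (intro allI impI)
  fix X Y Z p
  assume [simp]: "vector_field A X" "vector_field A Y" "vector_field A Z"
  let ?C = "\<lambda>X Y Z. F_tensor g D P X Y Z p + F_tensor g D P Y Z X p + F_tensor g D P Z X Y p"
  have 0: "?C (E i) (E j) (E k) = 0" for i j k
    by (simp add: F_tensor_frame assms)
  have 1: "?C X (E j) (E k) = 0" for j k
    by (rule tensorial_at_zero[where p = p and T = "\<lambda>X. ?C X (E j) (E k)", OF _ 0])
      ((intro tensorial_at_add tensorial_at_F_tensor; simp)+, simp)
  have 2: "?C X Y (E k) = 0" for k
    by (rule tensorial_at_zero[where p = p and T = "\<lambda>Y. ?C X Y (E k)", OF _ 1])
      ((intro tensorial_at_add tensorial_at_F_tensor; simp)+, simp)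
  show "?C X Y Z = 0"
    by (rule tensorial_at_zero[where p = p and T = "\<lambda>Z. ?C X Y Z", OF _ 2])
      ((intro tensorial_at_add tensorial_at_F_tensor; simp)+, simp)
qed

lemma nijenhuis_norm2_frame:
  fixes F :: "'i \<Rightarrow> 'a vfield"
  assumes "frame_at A p F"
  shows "nijenhuis_norm2 g P F p = (\<Sum>i\<in>UNIV. \<Sum>j\<in>UNIV. \<Sum>k\<in>UNIV. (nijenhuis_coeff i j k)\<^sup>2)"
  unfolding nijenhuis_norm2_def
  by (subst norm2_trace[where T = "nijenhuis P", OF assms tensorial_nijenhuis])
    (simp_all add: nijenhuis_frame g_lin_lin power2_eq_square)

lemma nabla_endo_norm2_frame:
  fixes F :: "'i \<Rightarrow> 'a vfield"
  assumes "frame_at A p F"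
  shows "nabla_endo_norm2 g D P F p = (\<Sum>i\<in>UNIV. \<Sum>j\<in>UNIV. \<Sum>k\<in>UNIV. (F_coeff i j k)\<^sup>2)"
  unfolding nabla_endo_norm2_def
  by (subst norm2_trace[where T = "nabla_endo D P", OF assms tensorial_nabla_endo])
    (simp_all add: nabla_endo_frame g_lin_lin power2_eq_square)

end

subsection \<open>The four-dimensional Lie algebra\<close>

lemma numeral_4_neq [simp]:
  "(1::4) \<noteq> 2" "(1::4) \<noteq> 3" "(1::4) \<noteq> 4" "(2::4) \<noteq> 3" "(2::4) \<noteq> 4" "(3::4) \<noteq> 4"
  "(2::4) \<noteq> 1" "(3::4) \<noteq> 1" "(4::4) \<noteq> 1" "(3::4) \<noteq> 2" "(4::4) \<noteq> 2" "(4::4) \<noteq> 3"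
  by simp_all

text \<open>The default rules decide such equations by modular arithmetic, which is too slow for the
  enumerations of index tuples below.\<close>

lemmas [simp del] = eq_numeral_iff_iszero [where 'a = "'a bit0"] for dummy :: "'a::finite"

text \<open>For distinct \<open>a\<close>, \<open>b\<close>, \<open>c\<close> these are the
  components of the 3-form that is the wedge product of the corresponding dual basis
  covectors.\<close>

definition perm_sign3 :: "4 \<Rightarrow> 4 \<Rightarrow> 4 \<Rightarrow> 4 \<Rightarrow> 4 \<Rightarrow> 4 \<Rightarrow> real" where
  "perm_sign3 a b c i j k =
     (if (i, j, k) \<in> {(a, b, c), (b, c, a), (c, a, b)} then 1
      else if (i, j, k) \<in> {(b, a, c), (a, c, b), (c, b, a)} then -1 else 0)"

text \<open>The 3-form g([_, _], _): the twelve coefficients in the six given brackets are, up to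
  sign, four values repeated three times each, one per basis 3-form.\<close>

definition str_const :: "real \<Rightarrow> real \<Rightarrow> real \<Rightarrow> real \<Rightarrow> 4 \<Rightarrow> 4 \<Rightarrow> 4 \<Rightarrow> real" where
  "str_const l1 l2 l3 l4 i j k =
     l1 * perm_sign3 1 2 3 i j k + l2 * perm_sign3 1 2 4 i j k
     + l3 * perm_sign3 2 3 4 i j k + l4 * perm_sign3 1 3 4 i j k"

lemma str_const_skew:
  "str_const l1 l2 l3 l4 j i k = - str_const l1 l2 l3 l4 i j k"
  "str_const l1 l2 l3 l4 i k j = - str_const l1 l2 l3 l4 i j k"
proof -
  have "\<forall>i j k. str_const l1 l2 l3 l4 j i k = - str_const l1 l2 l3 l4 i j k \<and>
      str_const l1 l2 l3 l4 i k j = - str_const l1 l2 l3 l4 i j k"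
    unfolding forall_4 by (simp add: str_const_def perm_sign3_def)
  then show "str_const l1 l2 l3 l4 j i k = - str_const l1 l2 l3 l4 i j k"
    "str_const l1 l2 l3 l4 i k j = - str_const l1 l2 l3 l4 i j k"
    by blast+
qed

lemma str_const_diagonal [simp]:
  "str_const l1 l2 l3 l4 i i k = 0" "str_const l1 l2 l3 l4 i k k = 0" "str_const l1 l2 l3 l4 i k i = 0"
  using str_const_skew[of l1 l2 l3 l4 i i k] str_const_skew[of l1 l2 l3 l4 i k k]
    str_const_skew(1)[of l1 l2 l3 l4 k i i] str_const_skew(2)[of l1 l2 l3 l4 k i i] by simp_all

lemma str_const_values [simp]:
  "str_const l1 l2 l3 l4 1 2 3 = l1" "str_const l1 l2 l3 l4 2 3 1 = l1" "str_const l1 l2 l3 l4 3 1 2 = l1"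
  "str_const l1 l2 l3 l4 2 1 3 = - l1" "str_const l1 l2 l3 l4 1 3 2 = - l1" "str_const l1 l2 l3 l4 3 2 1 = - l1"
  "str_const l1 l2 l3 l4 1 2 4 = l2" "str_const l1 l2 l3 l4 2 4 1 = l2" "str_const l1 l2 l3 l4 4 1 2 = l2"
  "str_const l1 l2 l3 l4 2 1 4 = - l2" "str_const l1 l2 l3 l4 1 4 2 = - l2" "str_const l1 l2 l3 l4 4 2 1 = - l2"
  "str_const l1 l2 l3 l4 2 3 4 = l3" "str_const l1 l2 l3 l4 3 4 2 = l3" "str_const l1 l2 l3 l4 4 2 3 = l3"
  "str_const l1 l2 l3 l4 3 2 4 = - l3" "str_const l1 l2 l3 l4 2 4 3 = - l3" "str_const l1 l2 l3 l4 4 3 2 = - l3"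
  "str_const l1 l2 l3 l4 1 3 4 = l4" "str_const l1 l2 l3 l4 3 4 1 = l4" "str_const l1 l2 l3 l4 4 1 3 = l4"
  "str_const l1 l2 l3 l4 3 1 4 = - l4" "str_const l1 l2 l3 l4 1 4 3 = - l4" "str_const l1 l2 l3 l4 4 3 1 = - l4"
  by (simp_all add: str_const_def perm_sign3_def)

text \<open>The vector \<open>w\<close> with \<open>c i j k = (\<Sum>m. \<epsilon> i j k m * w m)\<close> for the structure constants \<open>c\<close>
  and the Levi-Civita symbol \<open>\<epsilon>\<close>.\<close>

definition dual_vector :: "real \<Rightarrow> real \<Rightarrow> real \<Rightarrow> real \<Rightarrow> 4 \<Rightarrow> real" where
  "dual_vector l1 l2 l3 l4 i =
     (if i = 1 then - l3 else if i = 2 then l4 else if i = 3 then - l2 else l1)"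

lemma dual_vector_simps [simp]:
  "dual_vector l1 l2 l3 l4 1 = - l3" "dual_vector l1 l2 l3 l4 2 = l4"
  "dual_vector l1 l2 l3 l4 3 = - l2" "dual_vector l1 l2 l3 l4 4 = l1"
  by (simp_all add: dual_vector_def)

definition swap4 :: "4 \<Rightarrow> 4" where
  "swap4 i = (if i = 1 then 3 else if i = 2 then 4 else if i = 3 then 1 else 2)"

lemma swap4_simps [simp]: "swap4 1 = 3" "swap4 2 = 4" "swap4 3 = 1" "swap4 4 = 2"
  by (simp_all add: swap4_def)

locale lambda_frame =
  skew_frame_4 A D g E "str_const l1 l2 l3 l4" +
  skew_product_frame A D g E "str_const l1 l2 l3 l4" P swap4
  for A :: "('a::{t2_space,second_countable_topology}, 'e::euclidean_space) chart set"
    and D :: "'a vfield \<Rightarrow> 'a vfield \<Rightarrow> 'a vfield"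
    and g :: "'a bilin_field"
    and E :: "4 \<Rightarrow> 'a vfield"
    and P :: "'a endo_field"
    and l1 l2 l3 l4 :: real
begin

abbreviation w :: "4 \<Rightarrow> real" where "w \<equiv> dual_vector l1 l2 l3 l4"

text \<open>By Jacobi the left side is - 1/4 times the sum over m of c i j m * c m k l, and
  contracting two Levi-Civita symbols yields products of Kronecker deltas. The proof instead
  evaluates the unsimplified \<open>curv_coeff\<close> on all 256 index tuples.\<close>

lemma curv_coeff_eq:
  "curv_coeff i j k l =
    1 / 4 * ((l1\<^sup>2 + l2\<^sup>2 + l3\<^sup>2 + l4\<^sup>2) * pi1_coeff i j k l
      - (of_bool (j = k) * w i * w l - of_bool (i = k) * w j * w l
         + of_bool (i = l) * w j * w k - of_bool (j = l) * w i * w k))"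
proof -
  have "\<forall>i j k l. curv_coeff i j k l =
    1 / 4 * ((l1\<^sup>2 + l2\<^sup>2 + l3\<^sup>2 + l4\<^sup>2) * pi1_coeff i j k l
      - (of_bool (j = k) * w i * w l - of_bool (i = k) * w j * w l
         + of_bool (i = l) * w j * w k - of_bool (j = l) * w i * w k))"
    unfolding forall_4
    by (simp add: curv_coeff_def pi1_coeff_def sum_4 power2_eq_square field_simps)
  then show ?thesis by blast
qed

lemma ricci_coeff_eq:
  "ricci_coeff i j = 1 / 2 * ((l1\<^sup>2 + l2\<^sup>2 + l3\<^sup>2 + l4\<^sup>2) * of_bool (i = j) - w i * w j)"
proof -
  have "\<forall>i j. ricci_coeff i j =
      1 / 2 * ((l1\<^sup>2 + l2\<^sup>2 + l3\<^sup>2 + l4\<^sup>2) * of_bool (i = j) - w i * w j)"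
    unfolding forall_4
    by (simp add: ricci_coeff_def curv_coeff_eq pi1_coeff_def sum_4 power2_eq_square field_simps)
  then show ?thesis by blast
qed

lemma scalar_coeff_eq: "scalar_coeff = 3 / 2 * (l1\<^sup>2 + l2\<^sup>2 + l3\<^sup>2 + l4\<^sup>2)"
  by (simp add: scalar_coeff_def ricci_coeff_eq sum_4 power2_eq_square field_simps)

text \<open>With s = |w|^2 and psi1(g) = 2 pi1, psi1(rho) = s pi1 - psi1(w (x) w) / 2 and tau / 3 =
  s / 2; half the difference psi1(rho) - s pi1 / 2 is \<open>curv_coeff_eq\<close>.\<close>

lemma weyl_zero: "weyl_zero A g D"
proof (rule weyl_zeroI)
  fix i j k l
  show "curv_coeff i j k l = 1 / 2 * (psi1_coeff i j k l - scalar_coeff / 3 * pi1_coeff i j k l)"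
    unfolding curv_coeff_eq psi1_coeff_def ricci_coeff_eq scalar_coeff_eq pi1_coeff_def
    by algebra
qed

text \<open>The six terms cancel in pairs because a skew \<open>c\<close> is cyclically invariant:
  the term with (i, swap4 j, k) meets the one with (k, i, swap4 j), and likewise for the
  others.\<close>

lemma F_cyclic: "F_coeff i j k + F_coeff j k i + F_coeff k i j = 0"
proof -
  have "\<forall>i j k. F_coeff i j k + F_coeff j k i + F_coeff k i j = 0"
    unfolding forall_4 by (simp add: F_coeff_def)
  then show ?thesis by blast
qed

lemma curv_coeff_sym:
  "curv_coeff i j k l = curv_coeff k l i j"
  "curv_coeff i j k l = - curv_coeff j i k l"
  "curv_coeff i j k l = - curv_coeff i j l k"
  \<comment> \<open>The equalities are oriented alike so that each delta is the same atom on both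
    sides.\<close>
  unfolding curv_coeff_eq pi1_coeff_def
    eq_commute[of l i] eq_commute[of k j] eq_commute[of k i] eq_commute[of l j]
  by algebra+

text \<open>Two disjoint index pairs give 0, since every term of \<open>curv_coeff_eq\<close> has a
  delta between the pairs. The list is otherwise complete: 6 entries with equal pairs and 12 for the
  unordered choices of two pairs sharing exactly one index, so the fourth case is
  contradictory.\<close>

lemma curv_coeff_support:
  fixes i j k l :: 4
  assumes "riem_orbit i j k l \<inter>
    {(1,2,2,1), (1,3,3,1), (1,4,4,1), (2,3,3,2), (2,4,4,2), (3,4,4,3),
     (1,3,4,1), (2,3,4,2), (3,1,2,3), (4,1,2,4), (1,2,3,1), (4,2,3,4),
     (2,1,4,2), (3,1,4,3), (1,2,4,1), (3,2,4,3), (2,1,3,2), (4,1,3,4)} = {}"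
  shows "curv_coeff i j k l = 0"
proof -
  consider "i = j" | "k = l" | "i \<notin> {k, l}" "j \<notin> {k, l}" | "i \<noteq> j" "k \<noteq> l" "{i, j} \<inter> {k, l} \<noteq> {}"
    by blast
  then show ?thesis
  proof cases
    case 4
    then have False
      using assms exhaust_4[of i] exhaust_4[of j] exhaust_4[of k] exhaust_4[of l]
      unfolding riem_orbit_def
      by (elim disjE; hypsubst) simp_all
    then show ?thesis ..
  qed (auto simp: curv_coeff_eq pi1_coeff_def)
qed

text \<open>Skewness in the last two indices exchanges the two terms of
  \<open>F_coeff\<close>.\<close>

lemma F_coeff_sym: "F_coeff i j k = F_coeff i k j"
  unfolding F_coeff_def str_const_skew(2)[of l1 l2 l3 l4 i "swap4 k" j]
    str_const_skew(2)[of l1 l2 l3 l4 i k "swap4 j"]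
  by simp

lemma F_coeff_support:
  fixes i j k :: 4
  defines "L \<equiv> {(2,1,1), (2,3,3), (1,3,4), (3,2,3), (1,1,2), (3,1,4),
                   (1,4,4), (1,2,2), (2,1,2), (4,2,3), (2,3,4), (4,1,4),
                   (3,2,2), (3,4,4), (2,1,4), (4,3,4), (2,2,3), (4,1,2),
                   (4,3,3), (4,1,1), (1,4,1), (3,2,1), (1,3,2), (3,3,4)} :: (4 \<times> 4 \<times> 4) set"
  assumes "(i, j, k) \<notin> L" "(i, k, j) \<notin> L"
  shows "F_coeff i j k = 0"
proof -
  have "\<forall>i j k. (i, j, k) \<notin> L \<longrightarrow> (i, k, j) \<notin> L \<longrightarrow> F_coeff i j k = 0"
    unfolding forall_4 L_def by (simp add: F_coeff_def)
  then show ?thesis using assms(2,3) by blast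
qed

lemma nijenhuis_norm2_eq:
  fixes F :: "4 \<Rightarrow> 'a vfield"
  shows "frame_at A p F \<Longrightarrow> nijenhuis_norm2 g P F p = 32 * (l1\<^sup>2 + l2\<^sup>2 + l3\<^sup>2 + l4\<^sup>2)"
  by (simp add: nijenhuis_norm2_frame sum_4 nijenhuis_coeff_def power2_eq_square field_simps)

lemma nabla_endo_norm2_eq:
  fixes F :: "4 \<Rightarrow> 'a vfield"
  shows "frame_at A p F \<Longrightarrow> nabla_endo_norm2 g D P F p = 4 * (l1\<^sup>2 + l2\<^sup>2 + l3\<^sup>2 + l4\<^sup>2)"
  by (simp add: nabla_endo_norm2_frame sum_4 F_coeff_def power2_eq_square field_simps)

lemma sectional_curvature_frame:
  "i \<noteq> j \<Longrightarrow> sectional_curvature g D (E i) (E j) p = curv_coeff i j j i"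
  by (simp add: sectional_curvature_def riem_frame pi1_def orthonormal)

lemma ricci_coeff_sym: "ricci_coeff i j = ricci_coeff j i"
  unfolding ricci_coeff_eq eq_commute[of j i] by simp

end

theorem theorem3p2:
  fixes A :: "('a::{t2_space,second_countable_topology}, real ^ 4) chart set"
    and mul :: "'a \<Rightarrow> 'a \<Rightarrow> 'a" and e :: 'a and iv :: "'a \<Rightarrow> 'a"
    and X :: "4 \<Rightarrow> 'a vfield"
    and g :: "'a bilin_field"
    and P :: "'a endo_field"
    and D :: "'a vfield \<Rightarrow> 'a vfield \<Rightarrow> 'a vfield"
    and l1 l2 l3 l4 :: real
  assumes lie_group: "lie_group A mul e iv"
    and connected: "connected (UNIV :: 'a set)"
    and X_left_invariant: "\<forall>i. left_invariant A mul (X i)"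
    and X_basis: "\<forall>p. tangent_basis A p (\<lambda>i. X i p)"
    and bracket12: "lie_bracket (X 1) (X 2) = l1 *\<^sub>R X 3 + l2 *\<^sub>R X 4"
    and bracket23: "lie_bracket (X 2) (X 3) = l1 *\<^sub>R X 1 + l3 *\<^sub>R X 4"
    and bracket13: "lie_bracket (X 1) (X 3) = - l1 *\<^sub>R X 2 + l4 *\<^sub>R X 4"
    and bracket24: "lie_bracket (X 2) (X 4) = l2 *\<^sub>R X 1 - l3 *\<^sub>R X 3"
    and bracket14: "lie_bracket (X 1) (X 4) = - l2 *\<^sub>R X 2 - l4 *\<^sub>R X 3"
    and bracket34: "lie_bracket (X 3) (X 4) = l4 *\<^sub>R X 1 + l3 *\<^sub>R X 2"
    and metric: "left_invariant_metric A mul g"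
    and orthonormal: "\<forall>p i j. g p (X i p) (X j p) = (if i = j then 1 else 0)"
    and P_almost_product: "almost_product A P"
    and P_left_invariant: "left_invariant_endo A mul P"
    and P_basis: "app_endo P (X 1) = X 3" "app_endo P (X 2) = X 4"
      "app_endo P (X 3) = X 1" "app_endo P (X 4) = X 2"
    and levi_civita: "levi_civita A g D"
  shows
    "(locally_symmetric A D \<and> W3_manifold A g D P \<and> killing_metric A mul g \<and> weyl_zero A g D)
   \<and>
     (\<forall>p. let F = (\<lambda>i j k. F_tensor g D P (X i) (X j) (X k) p);
              L = {(2,1,1), (2,3,3), (1,3,4), (3,2,3), (1,1,2), (3,1,4),
                   (1,4,4), (1,2,2), (2,1,2), (4,2,3), (2,3,4), (4,1,4),
                   (3,2,2), (3,4,4), (2,1,4), (4,3,4), (2,2,3), (4,1,2),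
                   (4,3,3), (4,1,1), (1,4,1), (3,2,1), (1,3,2), (3,3,4)}
          in F 2 1 1 = l1 \<and> - F 2 3 3 = l1 \<and> 2 * F 1 3 4 = l1 \<and> 2 * F 3 2 3 = l1 \<and>
               - 2 * F 1 1 2 = l1 \<and> - 2 * F 3 1 4 = l1 \<and>
             F 1 4 4 = l2 \<and> - F 1 2 2 = l2 \<and> 2 * F 2 1 2 = l2 \<and> 2 * F 4 2 3 = l2 \<and>
               - 2 * F 2 3 4 = l2 \<and> - 2 * F 4 1 4 = l2 \<and>
             F 3 2 2 = l3 \<and> - F 3 4 4 = l3 \<and> 2 * F 2 1 4 = l3 \<and> 2 * F 4 3 4 = l3 \<and>
               - 2 * F 2 2 3 = l3 \<and> - 2 * F 4 1 2 = l3 \<and>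
             F 4 3 3 = l4 \<and> - F 4 1 1 = l4 \<and> 2 * F 1 4 1 = l4 \<and> 2 * F 3 2 1 = l4 \<and>
               - 2 * F 1 3 2 = l4 \<and> - 2 * F 3 3 4 = l4 \<and>
             (\<forall>i j k. F i j k = F i k j) \<and>
             (\<forall>i j k. (i, j, k) \<notin> L \<longrightarrow> (i, k, j) \<notin> L \<longrightarrow> F i j k = 0))
   \<and>
     (\<forall>p. let R = (\<lambda>i j k s. riem g D (X i) (X j) (X k) (X s) p);
              L = {(1,2,2,1), (1,3,3,1), (1,4,4,1), (2,3,3,2), (2,4,4,2), (3,4,4,3),
                   (1,3,4,1), (2,3,4,2), (3,1,2,3), (4,1,2,4), (1,2,3,1), (4,2,3,4),
                   (2,1,4,2), (3,1,4,3), (1,2,4,1), (3,2,4,3), (2,1,3,2), (4,1,3,4)}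
          in R 1 2 2 1 = 1/4 * (l1\<^sup>2 + l2\<^sup>2) \<and>
             R 1 3 3 1 = 1/4 * (l1\<^sup>2 + l4\<^sup>2) \<and>
             R 1 4 4 1 = 1/4 * (l2\<^sup>2 + l4\<^sup>2) \<and>
             R 2 3 3 2 = 1/4 * (l1\<^sup>2 + l3\<^sup>2) \<and>
             R 2 4 4 2 = 1/4 * (l2\<^sup>2 + l3\<^sup>2) \<and>
             R 3 4 4 3 = 1/4 * (l3\<^sup>2 + l4\<^sup>2) \<and>
             R 1 3 4 1 = 1/4 * l1 * l2 \<and> R 2 3 4 2 = 1/4 * l1 * l2 \<and>
             R 3 1 2 3 = 1/4 * l3 * l4 \<and> R 4 1 2 4 = 1/4 * l3 * l4 \<and>
             R 1 2 3 1 = 1/4 * l2 * l4 \<and> R 4 2 3 4 = 1/4 * l2 * l4 \<and>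
             R 2 1 4 2 = 1/4 * l1 * l3 \<and> R 3 1 4 3 = 1/4 * l1 * l3 \<and>
             R 1 2 4 1 = - (1/4) * l1 * l4 \<and> R 3 2 4 3 = - (1/4) * l1 * l4 \<and>
             R 2 1 3 2 = - (1/4) * l2 * l3 \<and> R 4 1 3 4 = - (1/4) * l2 * l3 \<and>
             (\<forall>i j k s. R i j k s = R k s i j \<and> R i j k s = - R j i k s \<and>
                R i j k s = - R i j s k) \<and>
             (\<forall>i j k s. riem_orbit i j k s \<inter> L = {} \<longrightarrow> R i j k s = 0))
   \<and>
     (\<forall>p E :: 4 \<Rightarrow> 'a vfield. frame_at A p E \<longrightarrow>
         (let \<rho> = (\<lambda>i j. ricci g D E (X i) (X j) p)
          in \<rho> 1 1 = 1/2 * (l1\<^sup>2 + l2\<^sup>2 + l4\<^sup>2) \<and>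
             \<rho> 2 2 = 1/2 * (l1\<^sup>2 + l2\<^sup>2 + l3\<^sup>2) \<and>
             \<rho> 3 3 = 1/2 * (l1\<^sup>2 + l3\<^sup>2 + l4\<^sup>2) \<and>
             \<rho> 4 4 = 1/2 * (l2\<^sup>2 + l3\<^sup>2 + l4\<^sup>2) \<and>
             \<rho> 1 2 = 1/2 * l3 * l4 \<and> \<rho> 1 3 = - (1/2) * l2 * l3 \<and> \<rho> 1 4 = 1/2 * l1 * l3 \<and>
             \<rho> 2 3 = 1/2 * l2 * l4 \<and> \<rho> 2 4 = - (1/2) * l1 * l4 \<and> \<rho> 3 4 = 1/2 * l1 * l2 \<and>
             (\<forall>i j. \<rho> i j = \<rho> j i)))
   \<and>
     (\<forall>p E :: 4 \<Rightarrow> 'a vfield. frame_at A p E \<longrightarrow>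
         nijenhuis_norm2 g P E p = 32 * (l1\<^sup>2 + l2\<^sup>2 + l3\<^sup>2 + l4\<^sup>2) \<and>
         nabla_endo_norm2 g D P E p = 4 * (l1\<^sup>2 + l2\<^sup>2 + l3\<^sup>2 + l4\<^sup>2))
   \<and>
     (\<forall>p E :: 4 \<Rightarrow> 'a vfield. frame_at A p E \<longrightarrow>
         scalar_curvature g D E p = 3/2 * (l1\<^sup>2 + l2\<^sup>2 + l3\<^sup>2 + l4\<^sup>2))
   \<and>
     (\<forall>p. let k = (\<lambda>i j. sectional_curvature g D (X i) (X j) p)
          in k 1 2 = 1/4 * (l1\<^sup>2 + l2\<^sup>2) \<and>
             k 1 3 = 1/4 * (l1\<^sup>2 + l4\<^sup>2) \<and>
             k 1 4 = 1/4 * (l2\<^sup>2 + l4\<^sup>2) \<and>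
             k 2 3 = 1/4 * (l1\<^sup>2 + l3\<^sup>2) \<and>
             k 2 4 = 1/4 * (l2\<^sup>2 + l3\<^sup>2) \<and>
             k 3 4 = 1/4 * (l3\<^sup>2 + l4\<^sup>2))"
proof -
  have atlas: "smooth_atlas A" and grp: "group mul e iv"
    using lie_group by (simp_all add: lie_group_def)
  have met: "riemannian_metric A g"
    using metric by (simp add: left_invariant_metric_def)
  have aff: "affine_connection A D"
    using levi_civita by (simp add: levi_civita_def)
  \<comment> \<open>Six of the sixteen index pairs are given; antisymmetry yields their reversals
    and [Z, Z] = 0 the diagonal.\<close>
  have brackets: "\<forall>i j. lie_bracket (X i) (X j) = (\<Sum>k\<in>UNIV. str_const l1 l2 l3 l4 i j k *\<^sub>R X k)"
  proof -
    have "lie_bracket Z Z = 0" for Z :: "'a vfield"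
      by (simp add: lie_bracket_def fun_eq_iff)
    then show ?thesis
      unfolding forall_4 sum_4
      by (simp add: bracket12 bracket13 bracket14 bracket23 bracket24 bracket34
          lie_bracket_antisym[of "X 2" "X 1"] lie_bracket_antisym[of "X 3" "X 1"]
          lie_bracket_antisym[of "X 4" "X 1"] lie_bracket_antisym[of "X 3" "X 2"]
          lie_bracket_antisym[of "X 4" "X 2"] lie_bracket_antisym[of "X 4" "X 3"])
  qed
  have P_swap: "\<forall>i. app_endo P (X i) = X (swap4 i)"
    unfolding forall_4 by (simp add: P_basis)
  have swap: "\<forall>i. swap4 (swap4 i) = i"
    unfolding forall_4 by simp
  \<comment> \<open>The interpretation below introduces its own \<open>metric\<close>, the
    Riemannian axioms alone; the left invariance used for the Killing property is saved
    here.\<close>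
  note left_invariant_data = metric X_left_invariant
  interpret lambda_frame A D g X P l1 l2 l3 l4
  proof unfold_locales
    show "vector_field A (X i)" for i
      using X_left_invariant by (simp add: left_invariant_def)
    show "str_const l1 l2 l3 l4 j i k = - str_const l1 l2 l3 l4 i j k" for i j k by (rule str_const_skew(1))
    show "str_const l1 l2 l3 l4 i k j = - str_const l1 l2 l3 l4 i j k" for i j k by (rule str_const_skew(2))
  qed (use atlas aff met levi_civita P_almost_product X_basis orthonormal brackets P_swap swap
      in blast)+
  have "killing_metric A mul g"
    using left_invariant_data by (intro killing_metricI[OF grp]) blast+
  moreover have "W3_manifold A g D P"
    by (rule W3_manifoldI[OF F_cyclic])
  ultimately show ?thesis
    unfolding Let_def F_tensor_frame riem_frame
    using locally_symmetric weyl_zero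
    by - (intro conjI allI impI;
        (assumption | rule F_coeff_sym curv_coeff_sym
          | (rule F_coeff_support; assumption) | (rule curv_coeff_support; assumption)
          | simp add: F_coeff_def curv_coeff_eq pi1_coeff_def ricci_frame ricci_coeff_sym
              ricci_coeff_eq nijenhuis_norm2_eq nabla_endo_norm2_eq scalar_curvature_frame
              scalar_coeff_eq sectional_curvature_frame power2_eq_square field_simps))
qed

end
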